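(* Let $L$ be a chequerboard colourable oriented virtual link. Then a minimal crossing diagram of $L$ is chequerboard colourable; that is, every diagram $D$ of $L$ with the minimum number of classical crossings among all diagrams of $L$ is chequerboard colourable.
   Context: A virtual link diagram is a generic immersion of finitely many circles in the plane whose double points are marked either as classical crossings (with over/under information) or virtual crossings. A virtual link is an equivalence class of such diagrams under the virtual Reidemeister moves (the classical Reidemeister moves I, II, III together with the usual moves involving virtual crossings). A minimal crossing diagram of $L$ is a diagram with the minimum number of classical crossings, the minimum being taken across all diagrams of $L$. The abstract link diagram $F_D$ of $D$ is the pair of a compact surface with boundary and a link diagram on it, formed by placing a disc about each classical crossing, two separate discs at each virtual crossing (one around each of the two strands, so that the strands do not meet in the surface), and joining these discs by collars (bands) about the arcs of $D$; the surface deformation retracts onto the underlying curve of the diagram. $F_D$ is chequerboard colourable if the components of the complement of the underlying curves in the surface can be shaded or left unshaded so that exactly one side of each arc is shaded; thus at each classical crossing the four regions are alternately shaded and unshaded. A diagram $D$ is chequerboard colourable if $F_D$ is, and a virtual link is chequerboard colourable if it has a chequerboard colourable diagram. *)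

theory Defs
  imports "HOL-Analysis.Analysis"
begin

section \<open>Virtual link diagrams\<close>

text \<open>
  A diagram is an immersion in the plane (\<^typ>\<open>complex\<close>) of \<open>ncomp\<close> copies of the unit circle,
  which are oriented anticlockwise. The pair \<open>(i, z)\<close> denotes the point \<open>z\<close> of the \<open>i\<close>-th circle.
  The marking of the double points is the set \<open>over\<close> of the points of the circles that pass over a
  classical crossing. So a double point is classical if one of its two preimages is in \<open>over\<close>, and
  virtual if neither is.
\<close>

record vdiagram =
  ncomp :: nat
  strand :: "nat \<Rightarrow> complex \<Rightarrow> complex"
  over :: "(nat \<times> complex) set"

definition circles :: "vdiagram \<Rightarrow> (nat \<times> complex) set" where
  "circles D = {..<ncomp D} \<times> sphere 0 1"

definition pos :: "vdiagram \<Rightarrow> nat \<times> complex \<Rightarrow> complex" where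
  "pos D x = strand D (fst x) (snd x)"

definition velocity :: "vdiagram \<Rightarrow> nat \<times> complex \<Rightarrow> complex" where
  "velocity D x = vector_derivative (\<lambda>s. strand D (fst x) (snd x * cis s)) (at 0)"

definition double_pair :: "vdiagram \<Rightarrow> nat \<times> complex \<Rightarrow> nat \<times> complex \<Rightarrow> bool" where
  "double_pair D x y \<longleftrightarrow> x \<in> circles D \<and> y \<in> circles D \<and> x \<noteq> y \<and> pos D x = pos D y"

definition classical_pair :: "vdiagram \<Rightarrow> nat \<times> complex \<Rightarrow> nat \<times> complex \<Rightarrow> bool" where
  "classical_pair D x y \<longleftrightarrow> double_pair D x y \<and> (x \<in> over D \<or> y \<in> over D)"

text \<open>The determinant of two plane vectors: positive if \<open>v\<close> points to the left of \<open>u\<close>.\<close>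

definition cdet :: "complex \<Rightarrow> complex \<Rightarrow> real" where
  "cdet u v = Im (cnj u * v)"

definition generic_immersion :: "vdiagram \<Rightarrow> bool" where
  "generic_immersion D \<longleftrightarrow>
     (\<forall>i<ncomp D. (\<lambda>s. strand D i (cis s)) C1_differentiable_on UNIV) \<and>
     (\<forall>x\<in>circles D. velocity D x \<noteq> 0) \<and>
     (\<forall>x y. double_pair D x y \<longrightarrow> cdet (velocity D x) (velocity D y) \<noteq> 0) \<and>
     (\<forall>x y z. double_pair D x y \<and> double_pair D x z \<longrightarrow> y = z) \<and>
     finite {x. \<exists>y. double_pair D x y}"

definition virtual_link_diagram :: "vdiagram \<Rightarrow> bool" where
  "virtual_link_diagram D \<longleftrightarrow>
     generic_immersion D \<and> (\<forall>x\<in>over D. \<exists>y. double_pair D x y \<and> y \<notin> over D)"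

definition classical_crossings :: "vdiagram \<Rightarrow> complex set" where
  "classical_crossings D = {pos D x | x y. classical_pair D x y}"

definition crossing_number :: "vdiagram \<Rightarrow> nat" where
  "crossing_number D = card (classical_crossings D)"

section \<open>Planar isotopy\<close>

definition C1_map :: "(complex \<Rightarrow> complex) \<Rightarrow> bool" where
  "C1_map h \<longleftrightarrow> (\<exists>h' :: complex \<Rightarrow> complex \<Rightarrow>\<^sub>L complex.
     (\<forall>p. (h has_derivative blinfun_apply (h' p)) (at p)) \<and> continuous_on UNIV h')"

definition ambient_isotopy :: "(real \<Rightarrow> complex \<Rightarrow> complex) \<Rightarrow> bool" where
  "ambient_isotopy H \<longleftrightarrow>
     continuous_on ({0..1} \<times> UNIV) (\<lambda>(t, p). H t p) \<and> H 0 = id \<and>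
     (\<forall>t\<in>{0..1}. bij (H t) \<and> C1_map (H t) \<and> C1_map (inv (H t)))"

text \<open>
  The lift to the real line of an orientation-preserving diffeomorphism of the circle
  \<open>\<real> / 2 \<pi> \<int>\<close>.
\<close>

definition circle_reparam :: "(real \<Rightarrow> real) \<Rightarrow> bool" where
  "circle_reparam f \<longleftrightarrow>
     f C1_differentiable_on UNIV \<and> (\<forall>s. 0 < vector_derivative f (at s)) \<and>
     (\<forall>s. f (s + 2 * pi) = f s + 2 * pi)"

text \<open>
  Planar isotopy. Since the circles of a diagram are neither ordered nor equipped with more than
  an orientation, renumbering and oriented reparametrisation of the circles are included.
\<close>

definition isotopic :: "vdiagram \<Rightarrow> vdiagram \<Rightarrow> bool" where
  "isotopic D E \<longleftrightarrow>
     virtual_link_diagram D \<and> virtual_link_diagram E \<and> ncomp D = ncomp E \<and>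
     (\<exists>H \<pi> f. ambient_isotopy H \<and> bij_betw \<pi> {..<ncomp D} {..<ncomp D} \<and>
        (\<forall>i<ncomp D. circle_reparam (f i) \<and>
           (\<forall>s. pos E (i, cis s) = H 1 (pos D (\<pi> i, cis (f i s))) \<and>
                ((i, cis s) \<in> over E \<longleftrightarrow> (\<pi> i, cis (f i s)) \<in> over D))))"

section \<open>Virtual Reidemeister moves\<close>

text \<open>
  A move replaces the part of a diagram in a closed disc by another tangle with the same end
  points. Up to planar isotopy, the disc may be taken to be round. The triple \<open>(i, z, a)\<close> denotes
  the arc of length \<open>a\<close> on the \<open>i\<close>-th circle that starts at \<open>z\<close>.
\<close>

type_synonym arc = "nat \<times> complex \<times> real"

fun along :: "arc \<Rightarrow> real \<Rightarrow> nat \<times> complex" where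
  "along (i, z, a) s = (i, z * cis s)"

fun arc_params :: "arc \<Rightarrow> real set" where
  "arc_params (i, z, a) = {0..a}"

definition arc_set :: "arc \<Rightarrow> (nat \<times> complex) set" where
  "arc_set \<alpha> = along \<alpha> ` arc_params \<alpha>"

text \<open>
  The arcs in \<open>A\<close> are the strands of the tangle cut out of \<open>D\<close> by the disc with centre \<open>c\<close> and
  radius \<open>r\<close>; no crossing lies on the boundary of the disc.
\<close>

definition tangle_in_disc :: "complex \<Rightarrow> real \<Rightarrow> arc set \<Rightarrow> vdiagram \<Rightarrow> bool" where
  "tangle_in_disc c r A D \<longleftrightarrow>
     0 < r \<and>
     (\<forall>(i, z, a)\<in>A. (i, z) \<in> circles D \<and> 0 < a \<and> a < 2 * pi \<and>
        pos D (i, z) \<in> sphere c r \<and> pos D (i, z * cis a) \<in> sphere c r \<and>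
        (\<forall>s\<in>{0<..<a}. pos D (i, z * cis s) \<in> ball c r)) \<and>
     (\<forall>\<alpha>\<in>A. \<forall>\<beta>\<in>A. \<alpha> \<noteq> \<beta> \<longrightarrow> arc_set \<alpha> \<inter> arc_set \<beta> = {}) \<and>
     (\<forall>x\<in>circles D. pos D x \<in> cball c r \<longrightarrow> (\<exists>\<alpha>\<in>A. x \<in> arc_set \<alpha>)) \<and>
     (\<forall>x y. double_pair D x y \<longrightarrow> pos D x \<notin> sphere c r)"

definition tangle_replacement :: "arc set \<Rightarrow> vdiagram \<Rightarrow> vdiagram \<Rightarrow> bool" where
  "tangle_replacement A D E \<longleftrightarrow>
     virtual_link_diagram D \<and> virtual_link_diagram E \<and> ncomp D = ncomp E \<and>
     (\<exists>c r. tangle_in_disc c r A D \<and> tangle_in_disc c r A E) \<and>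
     (\<forall>x\<in>circles D - (\<Union>\<alpha>\<in>A. arc_set \<alpha>). pos D x = pos E x \<and> (x \<in> over D \<longleftrightarrow> x \<in> over E))"

definition meet :: "vdiagram \<Rightarrow> arc \<Rightarrow> arc \<Rightarrow> (real \<times> real) set" where
  "meet D \<alpha> \<beta> =
     {(s, t). s \<in> arc_params \<alpha> \<and> t \<in> arc_params \<beta> \<and> double_pair D (along \<alpha> s) (along \<beta> t)}"

definition is_over :: "vdiagram \<Rightarrow> arc \<Rightarrow> real \<Rightarrow> bool" where
  "is_over D \<alpha> s \<longleftrightarrow> along \<alpha> s \<in> over D"

text \<open>
  First move, classical or virtual: an embedded strand is replaced by a strand with one
  self-crossing, of either kind.
\<close>

definition reidemeister1 :: "vdiagram \<Rightarrow> vdiagram \<Rightarrow> bool" where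
  "reidemeister1 D E \<longleftrightarrow> (\<exists>\<alpha> s t. tangle_replacement {\<alpha>} D E \<and>
     meet D \<alpha> \<alpha> = {} \<and> meet E \<alpha> \<alpha> = {(s, t), (t, s)})"

text \<open>
  Second move, classical or virtual: two disjoint embedded strands are replaced by two embedded
  strands that meet twice, where the crossings are both virtual or the same strand is over at both.
\<close>

definition reidemeister2 :: "vdiagram \<Rightarrow> vdiagram \<Rightarrow> bool" where
  "reidemeister2 D E \<longleftrightarrow> (\<exists>\<alpha> \<beta> s1 t1 s2 t2. \<alpha> \<noteq> \<beta> \<and> tangle_replacement {\<alpha>, \<beta>} D E \<and>
     meet D \<alpha> \<alpha> = {} \<and> meet D \<beta> \<beta> = {} \<and> meet D \<alpha> \<beta> = {} \<and>
     meet E \<alpha> \<alpha> = {} \<and> meet E \<beta> \<beta> = {} \<and> meet E \<alpha> \<beta> = {(s1, t1), (s2, t2)} \<and> s1 \<noteq> s2 \<and>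
     (is_over E \<alpha> s1 \<longleftrightarrow> is_over E \<alpha> s2) \<and> (is_over E \<beta> t1 \<longleftrightarrow> is_over E \<beta> t2))"

text \<open>
  Third move: three embedded strands, any two of which meet once. The move preserves the kind of
  each of the three crossings and reverses the order in which each strand meets the other two.
  The parameters are those of the crossings: \<open>a1\<close>, \<open>b1\<close> of \<open>\<alpha>\<close> with \<open>\<beta>\<close>, \<open>a2\<close>, \<open>c1\<close> of \<open>\<alpha>\<close> with
  \<open>\<gamma>\<close>, and \<open>b2\<close>, \<open>c2\<close> of \<open>\<beta>\<close> with \<open>\<gamma>\<close>.
\<close>

definition triangle ::
  "vdiagram \<Rightarrow> arc \<Rightarrow> arc \<Rightarrow> arc \<Rightarrow> real \<times> real \<Rightarrow> real \<times> real \<Rightarrow> real \<times> real \<Rightarrow> bool" where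
  "triangle D \<alpha> \<beta> \<gamma> = (\<lambda>(a1, a2) (b1, b2) (c1, c2).
     meet D \<alpha> \<alpha> = {} \<and> meet D \<beta> \<beta> = {} \<and> meet D \<gamma> \<gamma> = {} \<and>
     meet D \<alpha> \<beta> = {(a1, b1)} \<and> meet D \<alpha> \<gamma> = {(a2, c1)} \<and> meet D \<beta> \<gamma> = {(b2, c2)})"

text \<open>
  The last conjunct of the move lists the admissible kinds of crossings, up to naming of the strands.
  Either all crossings are classical, with \<open>\<alpha>\<close> over \<open>\<beta>\<close> and \<open>\<gamma>\<close>, and \<open>\<beta>\<close> over \<open>\<gamma>\<close>, or \<open>\<alpha>\<close> has virtual
  crossings with \<open>\<beta>\<close> and \<open>\<gamma>\<close>, which cross each other virtually (virtual third move) or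
  classically (mixed move). The two forbidden moves, with exactly one virtual crossing, are excluded.
\<close>

definition reidemeister3 :: "vdiagram \<Rightarrow> vdiagram \<Rightarrow> bool" where
  "reidemeister3 D E \<longleftrightarrow> (\<exists>\<alpha> \<beta> \<gamma> a1 a2 b1 b2 c1 c2 a1' a2' b1' b2' c1' c2'.
     \<alpha> \<noteq> \<beta> \<and> \<alpha> \<noteq> \<gamma> \<and> \<beta> \<noteq> \<gamma> \<and> tangle_replacement {\<alpha>, \<beta>, \<gamma>} D E \<and>
     triangle D \<alpha> \<beta> \<gamma> (a1, a2) (b1, b2) (c1, c2) \<and>
     triangle E \<alpha> \<beta> \<gamma> (a1', a2') (b1', b2') (c1', c2') \<and>
     (a1 < a2 \<longleftrightarrow> a2' < a1') \<and> (b1 < b2 \<longleftrightarrow> b2' < b1') \<and> (c1 < c2 \<longleftrightarrow> c2' < c1') \<and>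
     (is_over D \<alpha> a1 \<longleftrightarrow> is_over E \<alpha> a1') \<and> (is_over D \<alpha> a2 \<longleftrightarrow> is_over E \<alpha> a2') \<and>
     (is_over D \<beta> b1 \<longleftrightarrow> is_over E \<beta> b1') \<and> (is_over D \<beta> b2 \<longleftrightarrow> is_over E \<beta> b2') \<and>
     (is_over D \<gamma> c1 \<longleftrightarrow> is_over E \<gamma> c1') \<and> (is_over D \<gamma> c2 \<longleftrightarrow> is_over E \<gamma> c2') \<and>
     (is_over D \<alpha> a1 \<and> is_over D \<alpha> a2 \<and> is_over D \<beta> b2 \<or>
      \<not> is_over D \<alpha> a1 \<and> \<not> is_over D \<beta> b1 \<and> \<not> is_over D \<alpha> a2 \<and> \<not> is_over D \<gamma> c1))"

definition virtual_move :: "vdiagram \<Rightarrow> vdiagram \<Rightarrow> bool" where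
  "virtual_move D E \<longleftrightarrow>
     isotopic D E \<or> reidemeister1 D E \<or> reidemeister2 D E \<or> reidemeister3 D E"

definition virtually_equivalent :: "vdiagram \<Rightarrow> vdiagram \<Rightarrow> bool" where
  "virtually_equivalent = (symclp virtual_move)\<^sup>*\<^sup>*"

definition oriented_virtual_links :: "vdiagram set set" where
  "oriented_virtual_links =
     {D. virtual_link_diagram D} // {(D, E). virtual_link_diagram D \<and> virtually_equivalent D E}"

definition minimal_crossing_diagram :: "vdiagram set \<Rightarrow> vdiagram \<Rightarrow> bool" where
  "minimal_crossing_diagram L D \<longleftrightarrow>
     D \<in> L \<and> (\<forall>E\<in>L. crossing_number D \<le> crossing_number E)"

section \<open>The abstract link diagram\<close>

definition quotient_topology :: "'a topology \<Rightarrow> ('a \<Rightarrow> 'b) \<Rightarrow> 'b topology" where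
  "quotient_topology X q =
     topology (\<lambda>U. U \<subseteq> q ` topspace X \<and> openin X {x \<in> topspace X. q x \<in> U})"

lemma openin_quotient_topology:
  "openin (quotient_topology X q) U \<longleftrightarrow>
     U \<subseteq> q ` topspace X \<and> openin X {x \<in> topspace X. q x \<in> U}"
proof -
  let ?P = "\<lambda>U. U \<subseteq> q ` topspace X \<and> openin X {x \<in> topspace X. q x \<in> U}"
  have "istopology ?P"
    unfolding istopology_def
  proof (intro conjI allI impI)
    fix S T assume S: "?P S" and T: "?P T"
    have "{x \<in> topspace X. q x \<in> S \<inter> T}
        = {x \<in> topspace X. q x \<in> S} \<inter> {x \<in> topspace X. q x \<in> T}" by blast
    with S T show "openin X {x \<in> topspace X. q x \<in> S \<inter> T}" by auto
    from S show "S \<inter> T \<subseteq> q ` topspace X" by blast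
  next
    fix K assume K: "\<forall>S\<in>K. ?P S"
    have "{x \<in> topspace X. q x \<in> \<Union>K} = (\<Union>S\<in>K. {x \<in> topspace X. q x \<in> S})" by blast
    with K show "openin X {x \<in> topspace X. q x \<in> \<Union>K}" by auto
    from K show "\<Union>K \<subseteq> q ` topspace X" by blast
  qed
  then show ?thesis
    unfolding quotient_topology_def by (simp add: topology_inverse')
qed

lemma topspace_quotient_topology [simp]:
  "topspace (quotient_topology X q) = q ` topspace X"
proof -
  have "{x \<in> topspace X. q x \<in> q ` topspace X} = topspace X" by blast
  then have "openin (quotient_topology X q) (q ` topspace X)"
    by (simp add: openin_quotient_topology)
  then show ?thesis
    by (metis openin_quotient_topology openin_subset openin_topspace subset_antisym)
qed

lemma quotient_map_quotient_topology: "quotient_map X (quotient_topology X q) q"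
  unfolding quotient_map_def by (simp add: openin_quotient_topology)

text \<open>
  The discs and collars that lie along one circle of the diagram form an annulus, the product of
  the circle with \<open>[-1, 1]\<close>, where the second coordinate increases to the left of the circle.
  The surface is obtained by plumbing the annuli: the disc about a classical crossing is a square in
  each of the annuli of its two strands, and these squares are identified by a quarter turn.
  Nothing is identified at a virtual crossing, so that it has a separate disc on each strand.
\<close>

definition annuli :: "vdiagram \<Rightarrow> (nat \<times> complex \<times> real) set" where
  "annuli D = {(i, z, b). (i, z) \<in> circles D \<and> b \<in> {-1..1}}"

definition classical_points :: "vdiagram \<Rightarrow> (nat \<times> complex) set" where
  "classical_points D = {x. \<exists>y. classical_pair D x y}"

text \<open>
  The discs about the classical crossings have half-width \<open>e\<close> along the circles; they have to be
  embedded and pairwise disjoint.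
\<close>

definition disc_width :: "vdiagram \<Rightarrow> real \<Rightarrow> bool" where
  "disc_width D e \<longleftrightarrow>
     0 < e \<and> inj_on (\<lambda>((i, z), s). (i, z * cis s)) (classical_points D \<times> {-e..e})"

text \<open>
  Let \<open>\<sigma>\<close> be the sign of the frame of the two strands. If \<open>\<sigma> = 1\<close>, the strand through \<open>(j, w)\<close> crosses the
  one through \<open>(i, z)\<close> from right to left. So its forward direction is the left of the strand
  through \<open>(i, z)\<close>, and its left is the backward direction of that strand. Both are reversed if
  \<open>\<sigma> = -1\<close>. The relation is symmetric, as \<open>\<sigma>\<close> changes sign when the strands are exchanged.
\<close>

definition plumbing :: "vdiagram \<Rightarrow> real \<Rightarrow> ((nat \<times> complex \<times> real) \<times> (nat \<times> complex \<times> real)) set" where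
  "plumbing D e =
     {((i, z * cis (e * a), b), (j, w * cis (e * \<sigma> * b), - \<sigma> * a)) | i z j w \<sigma> a b.
        classical_pair D (i, z) (j, w) \<and> \<sigma> = sgn (cdet (velocity D (i, z)) (velocity D (j, w))) \<and>
        a \<in> {-1..1} \<and> b \<in> {-1..1}}"

definition surface_point ::
  "vdiagram \<Rightarrow> real \<Rightarrow> nat \<times> complex \<times> real \<Rightarrow> (nat \<times> complex \<times> real) set" where
  "surface_point D e p = (plumbing D e)\<^sup>* `` {p}"

definition abstract_link_surface :: "vdiagram \<Rightarrow> real \<Rightarrow> (nat \<times> complex \<times> real) set topology" where
  "abstract_link_surface D e = quotient_topology (top_of_set (annuli D)) (surface_point D e)"

definition underlying_curve :: "vdiagram \<Rightarrow> real \<Rightarrow> (nat \<times> complex \<times> real) set set" where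
  "underlying_curve D e = {surface_point D e (i, z, 0) | i z. (i, z) \<in> circles D}"

definition regions :: "vdiagram \<Rightarrow> real \<Rightarrow> (nat \<times> complex \<times> real) set set set" where
  "regions D e = connected_components_of
     (subtopology (abstract_link_surface D e)
        (topspace (abstract_link_surface D e) - underlying_curve D e))"

section \<open>Chequerboard colourability\<close>

text \<open>
  The points of the circles outside \<^term>\<open>classical_points D\<close> are the points of the arcs.
  The two sides of an arc at \<open>(i, z)\<close> are the segments \<open>{(i, z)} \<times> {0<..1}\<close> and \<open>{(i, z)} \<times> {-1..<0}\<close>.
\<close>

definition chequerboard_shading ::
  "vdiagram \<Rightarrow> real \<Rightarrow> (nat \<times> complex \<times> real) set set set \<Rightarrow> bool" where
  "chequerboard_shading D e \<S> \<longleftrightarrow>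
     \<S> \<subseteq> regions D e \<and>
     (\<forall>(i, z)\<in>circles D - classical_points D. \<forall>b\<in>{0<..1}.
        (surface_point D e (i, z, b) \<in> \<Union>\<S>) \<noteq> (surface_point D e (i, z, - b) \<in> \<Union>\<S>))"

text \<open>
  All choices of the width give homeomorphic pairs of surface and curve, so that it does not matter
  which one is used.
\<close>

definition chequerboard_colourable :: "vdiagram \<Rightarrow> bool" where
  "chequerboard_colourable D \<longleftrightarrow> (\<exists>e \<S>. disc_width D e \<and> chequerboard_shading D e \<S>)"

definition chequerboard_colourable_link :: "vdiagram set \<Rightarrow> bool" where
  "chequerboard_colourable_link L \<longleftrightarrow> (\<exists>D\<in>L. chequerboard_colourable D)"

end

theory Submission
  imports Defs
begin

text \<open>
  A shading of the complement of the curve is the same as a choice, for each arc, of the side which is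
  shaded. This choice changes whenever a strand passes a classical crossing, and the two incoming
  arcs of each crossing have opposite values. A choice that satisfies only the first condition can
  be carried along any sequence of moves, as a move does not change the parity of the number of
  classical crossings on a strand of its tangle. The crossings that satisfy the second condition are
  called even, and the odd ones are made virtual. Since the two crossings
  of a second move have the same parity and an even number of those of a third move is odd, equivalent
  diagrams have equivalent projections. If the shading of a colourable diagram is carried along to a
  minimal diagram, then the projection of the latter represents the same link, and by minimality no
  crossing was odd.
\<close>

section \<open>Alternating functions on the circles\<close>

text \<open>Labels are not unique: they can be negated on each circle separately, and this changes
  the parity of the crossings between different circles. So a projection belongs to a labelled
  diagram, and an equivalence has to carry the labels along with the diagrams. The colourable
  diagram at the start is its own projection, because its shading makes all its crossings even; for
  this reason the projection at the other end lies in the same link. Incoming labels at a crossing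
  are opposite for the following reason. The region to the left of one incoming arc is, seen from
  the other strand, either to the left of its outgoing arc or to the right of its incoming arc,
  depending on the sign of the crossing. In both cases the left of the other incoming arc has the
  opposite shade. For a third move with three classical crossings, each strand has different labels
  at its two crossings. The three label differences at the crossings thus add up to 3 modulo 2, so
  an odd number of the crossings is even.\<close>

lemma cis_eq_cis_iff: "cis s = cis t \<longleftrightarrow> (\<exists>n::int. s = t + 2 * pi * n)"
  using sin_cos_eq_iff[of s t] by (auto simp: complex_eq_iff)

lemma cis_add_2pi_nat: "cis (s + 2 * pi * real k) = cis s"
  unfolding cis_eq_cis_iff by (rule exI[of _ "int k"]) simp

lemma cis_eq_cis_close:
  assumes "cis s = cis t" "\<bar>s - t\<bar> < 2 * pi"
  shows "s = t"
proof -
  obtain n :: int where n: "s = t + 2 * pi * n"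
    using assms(1) cis_eq_cis_iff by blast
  then have "2 * pi * \<bar>real_of_int n\<bar> < 2 * pi * 1"
    using assms(2) by (simp add: abs_mult)
  then have "\<bar>real_of_int n\<bar> < 1"
    using pi_gt_zero by (subst (asm) mult_less_cancel_left_pos) auto
  then have "n = 0" by linarith
  with n show ?thesis by simp
qed

text \<open>The window may begin at any \<theta>, so that the circle can be cut open at the start of
  a given arc instead of at the branch cut of \<open>Arg\<close>.\<close>

lemma sphere_cis_from:
  assumes "w \<in> sphere 0 1"
  obtains u where "\<theta> \<le> u" "u < \<theta> + 2 * pi" "w = cis u"
proof -
  have "w = cis (Arg w)"
    using assms cis_Arg[of w] by (cases "w = 0") (simp_all add: sgn_div_norm)
  moreover define k where "k = \<lfloor>(Arg w - \<theta>) / (2 * pi)\<rfloor>"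
  moreover have "cis (Arg w - 2 * pi * k) = cis (Arg w)"
    unfolding cis_eq_cis_iff by (rule exI[of _ "- k"]) simp
  moreover have "k \<le> (Arg w - \<theta>) / (2 * pi)" "(Arg w - \<theta>) / (2 * pi) < k + 1"
    unfolding k_def by linarith+
  then have "\<theta> \<le> Arg w - 2 * pi * k" "Arg w - 2 * pi * k < \<theta> + 2 * pi"
    by (simp_all add: field_simps)
  ultimately show ?thesis using that by metis
qed

text \<open>The lifts of one point of the circle form an arithmetic progression of step 2 pi, which
  meets a bounded interval in finitely many terms.\<close>

lemma finite_cis_vimage:
  assumes "finite C"
  shows "finite {t \<in> {s..<s'}. (i, cis t) \<in> C}"
proof -
  have "finite {t \<in> {s..<s'}. cis t = w}" for w
  proof (cases "\<exists>u. w = cis u")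
    case True
    then obtain u where u: "w = cis u" by blast
    have "{t \<in> {s..<s'}. cis t = w}
        \<subseteq> (\<lambda>n::int. u + 2 * pi * n) ` {\<lfloor>(s - u) / (2 * pi)\<rfloor>..\<lceil>(s' - u) / (2 * pi)\<rceil>}"
    proof
      fix t assume t: "t \<in> {t \<in> {s..<s'}. cis t = w}"
      then obtain n :: int where n: "t = u + 2 * pi * n"
        using u cis_eq_cis_iff by blast
      then have "(s - u) / (2 * pi) \<le> n" "n \<le> (s' - u) / (2 * pi)"
        using t by (simp_all add: field_simps)
      then have "\<lfloor>(s - u) / (2 * pi)\<rfloor> \<le> n" "n \<le> \<lceil>(s' - u) / (2 * pi)\<rceil>" by linarith+
      with n show "t \<in> (\<lambda>n::int. u + 2 * pi * n) ` {\<lfloor>(s - u) / (2 * pi)\<rfloor>..\<lceil>(s' - u) / (2 * pi)\<rceil>}"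
        by auto
    qed
    then show ?thesis by (rule finite_subset) simp
  next
    case False
    then have "{t \<in> {s..<s'}. cis t = w} = {}" by auto
    then show ?thesis by (simp only: finite.emptyI)
  qed
  then have "finite (\<Union>x\<in>C. {t \<in> {s..<s'}. cis t = snd x})" using assms by blast
  then show ?thesis by (rule rev_finite_subset) force
qed

text \<open>The parameters are lifts to the real line and may span several turns. The interval is
  half-open so that adjacent intervals add up, and so that a crossing at the end of the interval is
  not yet counted: its point still belongs to the incoming arc.\<close>

definition odd_between :: "('i \<times> complex) set \<Rightarrow> 'i \<Rightarrow> real \<Rightarrow> real \<Rightarrow> bool" where
  "odd_between C i s s' \<longleftrightarrow> odd (card {t \<in> {s..<s'}. (i, cis t) \<in> C})"

lemma odd_between_split:
  assumes "finite C" "s \<le> u" "u \<le> s'"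
  shows "odd_between C i s s' \<longleftrightarrow> (odd_between C i s u \<noteq> odd_between C i u s')"
proof -
  have "{t \<in> {s..<s'}. (i, cis t) \<in> C} = {t \<in> {s..<u}. (i, cis t) \<in> C} \<union> {t \<in> {u..<s'}. (i, cis t) \<in> C}"
    using assms by auto
  moreover have "{t \<in> {s..<u}. (i, cis t) \<in> C} \<inter> {t \<in> {u..<s'}. (i, cis t) \<in> C} = {}" by auto
  ultimately show ?thesis
    unfolding odd_between_def
    using finite_cis_vimage[OF assms(1)] by (simp add: card_Un_disjoint del: Int_iff)
qed

lemma odd_between_cong:
  assumes "\<And>t. s \<le> t \<Longrightarrow> t < s' \<Longrightarrow> (i, cis t) \<in> C \<longleftrightarrow> (i, cis t) \<in> C'"
  shows "odd_between C i s s' \<longleftrightarrow> odd_between C' i s s'"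
proof -
  have "{t \<in> {s..<s'}. (i, cis t) \<in> C} = {t \<in> {s..<s'}. (i, cis t) \<in> C'}"
    using assms by auto
  then show ?thesis by (simp add: odd_between_def)
qed

text \<open>An increasing bijection of the line matches the lifts in corresponding intervals. It is
  applied to full turns and to the reparametrisations of an isotopy.\<close>

lemma odd_between_reparam:
  assumes "strict_mono f" "surj f"
    and "\<And>t. (i, cis t) \<in> C \<longleftrightarrow> (j, cis (f t)) \<in> C'"
  shows "odd_between C i s s' \<longleftrightarrow> odd_between C' j (f s) (f s')"
proof -
  have "bij_betw f {t \<in> {s..<s'}. (i, cis t) \<in> C} {t \<in> {f s..<f s'}. (j, cis t) \<in> C'}"
    unfolding bij_betw_def
  proof
    show "inj_on f {t \<in> {s..<s'}. (i, cis t) \<in> C}"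
      using assms(1) strict_mono_imp_inj_on inj_on_subset by blast
    show "f ` {t \<in> {s..<s'}. (i, cis t) \<in> C} = {t \<in> {f s..<f s'}. (j, cis t) \<in> C'}"
    proof (intro subset_antisym subsetI)
      fix u assume u: "u \<in> {t \<in> {f s..<f s'}. (j, cis t) \<in> C'}"
      obtain t where "u = f t" using \<open>surj f\<close> by blast
      with u show "u \<in> f ` {t \<in> {s..<s'}. (i, cis t) \<in> C}"
        using assms by (auto simp: strict_mono_less strict_mono_less_eq)
    qed (use assms in \<open>auto simp: strict_mono_less strict_mono_less_eq\<close>)
  qed
  then show ?thesis by (simp add: odd_between_def bij_betw_same_card)
qed

lemma odd_between_shift:
  "odd_between C i (s + 2 * pi * real k) (s' + 2 * pi * real k) \<longleftrightarrow> odd_between C i s s'"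
proof -
  have "surj (\<lambda>t. t + 2 * pi * real k)" by (rule surjI[of _ "\<lambda>t. t - 2 * pi * real k"]) simp
  then show ?thesis
    using odd_between_reparam[of "\<lambda>t. t + 2 * pi * real k" i C i C s s']
    by (simp add: strict_mono_def cis_add_2pi_nat)
qed

text \<open>A window of one turn meets every point of the circle exactly once.\<close>

lemma odd_between_circle:
  assumes "C \<subseteq> UNIV \<times> sphere 0 1"
  shows "odd_between C i s (s + 2 * pi) \<longleftrightarrow> odd (card {x \<in> C. fst x = i})"
proof -
  have "bij_betw (\<lambda>t. (i, cis t)) {t \<in> {s..<s + 2 * pi}. (i, cis t) \<in> C} {x \<in> C. fst x = i}"
    unfolding bij_betw_def
  proof
    show "inj_on (\<lambda>t. (i, cis t)) {t \<in> {s..<s + 2 * pi}. (i, cis t) \<in> C}"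
      by (rule inj_onI) (auto intro!: cis_eq_cis_close)
    show "(\<lambda>t. (i, cis t)) ` {t \<in> {s..<s + 2 * pi}. (i, cis t) \<in> C} = {x \<in> C. fst x = i}"
    proof (intro subset_antisym subsetI)
      fix x assume x: "x \<in> {x \<in> C. fst x = i}"
      then have "snd x \<in> sphere 0 1" using assms by auto
      then obtain u where "s \<le> u" "u < s + 2 * pi" "snd x = cis u"
        by (rule sphere_cis_from)
      with x show "x \<in> (\<lambda>t. (i, cis t)) ` {t \<in> {s..<s + 2 * pi}. (i, cis t) \<in> C}"
        by (cases x) (auto intro!: image_eqI[of _ _ u])
    qed auto
  qed
  then show ?thesis by (simp add: odd_between_def bij_betw_same_card)
qed

text \<open>
  With \<open>C\<close> the classical points, \<open>\<kappa>\<close> tells whether the left side of an arc is shaded. At a point of \<open>C\<close>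
  itself, it has the value of the incoming arc.
\<close>

definition alternating :: "nat \<Rightarrow> (nat \<times> complex) set \<Rightarrow> (nat \<times> complex \<Rightarrow> bool) \<Rightarrow> bool" where
  "alternating n C \<kappa> \<longleftrightarrow>
     (\<forall>i<n. \<forall>s s'. s \<le> s' \<longrightarrow> \<kappa> (i, cis s') = (\<kappa> (i, cis s) \<noteq> odd_between C i s s'))"

lemma alternatingD:
  "alternating n C \<kappa> \<Longrightarrow> i < n \<Longrightarrow> s \<le> s' \<Longrightarrow> \<kappa> (i, cis s') = (\<kappa> (i, cis s) \<noteq> odd_between C i s s')"
  unfolding alternating_def by blast

text \<open>The values are fixed on the line by counting from \<theta>. As a full turn passes an
  even number of crossings, they descend to the circle.\<close>

lemma alternating_on_circle_exists:
  assumes C: "finite C" "C \<subseteq> UNIV \<times> sphere 0 1"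
    and even: "even (card {x \<in> C. fst x = i})"
  obtains \<phi> where "\<phi> (cis \<theta>) = b"
    "\<And>s s'. s \<le> s' \<Longrightarrow> \<phi> (cis s') = (\<phi> (cis s) \<noteq> odd_between C i s s')"
proof -
  define F where "F u = (b \<noteq> odd_between C i \<theta> u)" for u
  \<comment> \<open>Only lifts from \<theta> onwards carry the right value, since before \<theta>
    the interval counted by \<open>F\<close> is empty. By \<open>wd\<close>, the choice among these
    lifts does not matter.\<close>
  define \<phi> where "\<phi> w = F (SOME u. \<theta> \<le> u \<and> cis u = w)" for w
  have period: "F (u + 2 * pi * real k) = F u" if "\<theta> \<le> u" for u k
  proof (induction k)
    case (Suc k)
    have "F (u + 2 * pi * real (Suc k)) = F ((u + 2 * pi * real k) + 2 * pi)"
      by (simp add: algebra_simps)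
    also have "\<dots> = F (u + 2 * pi * real k)"
      unfolding F_def
      using that add_increasing2[of "2 * pi * real k" \<theta> u]
        odd_between_circle[OF C(2), of i "u + 2 * pi * real k"] even
        odd_between_split[OF C(1), of \<theta> "u + 2 * pi * real k" "(u + 2 * pi * real k) + 2 * pi" i]
      by simp
    finally show ?case using Suc by simp
  qed simp
  have wd: "F u = F v" if uv: "\<theta> \<le> u" "\<theta> \<le> v" "cis u = cis v" for u v
  proof -
    obtain n :: int where n: "u = v + 2 * pi * n"
      using uv(3) cis_eq_cis_iff by blast
    show ?thesis
    proof (cases "0 \<le> n")
      case True
      then show ?thesis using period[OF uv(2), of "nat n"] n by simp
    next
      case False
      then have "v = u + 2 * pi * real (nat (- n))" using n by simp
      then show ?thesis using period[OF uv(1), of "nat (- n)"] by simp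
    qed
  qed
  have \<phi>: "\<phi> (cis u) = F u" if "\<theta> \<le> u" for u
  proof -
    let ?v = "SOME v. \<theta> \<le> v \<and> cis v = cis u"
    have "\<theta> \<le> ?v \<and> cis ?v = cis u" by (rule someI[of _ u]) (use that in simp)
    then show ?thesis unfolding \<phi>_def using wd that by blast
  qed
  show ?thesis
  proof
    show "\<phi> (cis \<theta>) = b" by (simp add: \<phi> F_def odd_between_def)
    fix s s' :: real assume le: "s \<le> s'"
    \<comment> \<open>Both parameters are moved by whole turns past \<theta>, where \<phi> is given
      by \<open>F\<close>.\<close>
    obtain k where "(\<theta> - s) / (2 * pi) \<le> real k" using real_arch_simple by blast
    then have k: "\<theta> \<le> s + 2 * pi * real k" by (simp add: field_simps)
    have "\<phi> (cis s') = F (s' + 2 * pi * real k)" "\<phi> (cis s) = F (s + 2 * pi * real k)"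
      using \<phi>[of "s' + 2 * pi * real k"] \<phi>[of "s + 2 * pi * real k"] k le
      by (simp_all add: cis_add_2pi_nat)
    then show "\<phi> (cis s') = (\<phi> (cis s) \<noteq> odd_between C i s s')"
      unfolding F_def
      using odd_between_split[OF C(1) k, of "s' + 2 * pi * real k" i] le odd_between_shift[of C i s k s']
      by auto
  qed
qed

section \<open>Changing the crossings along arcs\<close>

definition crossings_on :: "(nat \<times> complex) set \<Rightarrow> arc \<Rightarrow> real set" where
  "crossings_on C \<alpha> = {t \<in> arc_params \<alpha>. along \<alpha> t \<in> C}"

fun proper_arc :: "nat \<Rightarrow> arc \<Rightarrow> bool" where
  "proper_arc n (i, z, a) \<longleftrightarrow> i < n \<and> z \<in> sphere 0 1 \<and> 0 < a \<and> a < 2 * pi"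

fun arc_length :: "arc \<Rightarrow> real" where
  "arc_length (i, z, a) = a"

lemma proper_arc_along_inj:
  assumes "proper_arc n \<alpha>" "s \<in> arc_params \<alpha>" "t \<in> arc_params \<alpha>" "along \<alpha> s = along \<alpha> t"
  shows "s = t"
proof -
  obtain i z a where [simp]: "\<alpha> = (i, z, a)" by (cases \<alpha>)
  have "z \<noteq> 0" using assms(1) by auto
  then show ?thesis using assms by (auto intro!: cis_eq_cis_close)
qed

lemma proper_arc_along_in_circles:
  assumes "proper_arc n \<alpha>"
  shows "along \<alpha> t \<in> {..<n} \<times> sphere 0 1"
  using assms by (cases \<alpha>) (auto simp: norm_mult)

lemma alternating_along:
  assumes alt: "alternating n C \<kappa>" and \<alpha>: "proper_arc n \<alpha>" and t: "t \<in> arc_params \<alpha>"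
  shows "\<kappa> (along \<alpha> t) = (\<kappa> (along \<alpha> 0) \<noteq> odd (card {u \<in> crossings_on C \<alpha>. u < t}))"
proof -
  obtain i z a where [simp]: "\<alpha> = (i, z, a)" by (cases \<alpha>)
  obtain \<theta> where \<theta>: "z = cis \<theta>" using \<alpha> sphere_cis_from[of z 0] by auto
  have "bij_betw (\<lambda>u. \<theta> + u) {u \<in> crossings_on C \<alpha>. u < t} {u \<in> {\<theta>..<\<theta> + t}. (i, cis u) \<in> C}"
    by (rule bij_betw_byWitness[of _ "\<lambda>u. u - \<theta>"])
      (use t \<theta> in \<open>auto simp: crossings_on_def cis_mult\<close>)
  from bij_betw_same_card[OF this]
  have "odd (card {u \<in> crossings_on C \<alpha>. u < t}) \<longleftrightarrow> odd_between C i \<theta> (\<theta> + t)"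
    by (simp add: odd_between_def)
  then show ?thesis
    using alternatingD[OF alt, of i \<theta> "\<theta> + t"] \<alpha> t \<theta> by (simp add: cis_mult)
qed

text \<open>An arc that keeps the parity of its crossings hands the same label on to the rest of its
  circle. So the new labels can be counted from the old value at the start of the arc, and they
  agree with the old ones off the arc. The end point is kept out of both sets because the arc is
  closed while the counted intervals are half-open.\<close>

lemma alternating_replace_arc:
  assumes alt: "alternating n C \<kappa>"
    and C: "finite C" "C \<subseteq> UNIV \<times> sphere 0 1" and C': "finite C'" "C' \<subseteq> UNIV \<times> sphere 0 1"
    and \<alpha>: "proper_arc n \<alpha>"
    and out: "\<And>x. x \<notin> arc_set \<alpha> \<Longrightarrow> x \<in> C \<longleftrightarrow> x \<in> C'"
    and parity: "odd (card (crossings_on C \<alpha>)) \<longleftrightarrow> odd (card (crossings_on C' \<alpha>))"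
    and stop: "along \<alpha> (arc_length \<alpha>) \<notin> C" "along \<alpha> (arc_length \<alpha>) \<notin> C'"
  obtains \<kappa>' where "alternating n C' \<kappa>'" "\<kappa>' (along \<alpha> 0) = \<kappa> (along \<alpha> 0)"
    "\<And>x. x \<in> UNIV \<times> sphere 0 1 \<Longrightarrow> x \<notin> arc_set \<alpha> \<Longrightarrow> \<kappa>' x = \<kappa> x"
proof -
  obtain i z a where [simp]: "\<alpha> = (i, z, a)" by (cases \<alpha>)
  have a: "0 < a" "a < 2 * pi" and i: "i < n" using \<alpha> by auto
  obtain \<theta> where \<theta>: "z = cis \<theta>" using \<alpha> sphere_cis_from[of z 0] by auto
  have on_arc: "odd_between B i \<theta> (\<theta> + a) \<longleftrightarrow> odd (card (crossings_on B \<alpha>))"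
    if "along \<alpha> (arc_length \<alpha>) \<notin> B" for B
  proof -
    have "bij_betw (\<lambda>u. \<theta> + u) (crossings_on B \<alpha>) {u \<in> {\<theta>..<\<theta> + a}. (i, cis u) \<in> B}"
      by (rule bij_betw_byWitness[of _ "\<lambda>u. u - \<theta>"])
        (use that \<theta> in \<open>auto simp: crossings_on_def cis_mult order.strict_iff_order\<close>)
    from bij_betw_same_card[OF this] show ?thesis by (simp add: odd_between_def)
  qed
  have outside: "(i, cis u) \<notin> arc_set \<alpha>" if "\<theta> + a < u" "u < \<theta> + 2 * pi" for u
  proof
    assume "(i, cis u) \<in> arc_set \<alpha>"
    then obtain t where "t \<in> {0..a}" "cis u = cis (\<theta> + t)"
      using \<theta> by (auto simp: arc_set_def cis_mult)
    then have "u = \<theta> + t" using that by (intro cis_eq_cis_close) auto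
    with \<open>t \<in> {0..a}\<close> that show False by simp
  qed
  \<comment> \<open>The two counts have the same parity over the arc, and from its end onwards the
    two sets coincide until the turn is complete.\<close>
  have agree: "odd_between C' i \<theta> u \<longleftrightarrow> odd_between C i \<theta> u"
    if u: "\<theta> + a \<le> u" "u \<le> \<theta> + 2 * pi" for u
  proof -
    have "odd_between C' i (\<theta> + a) u \<longleftrightarrow> odd_between C i (\<theta> + a) u"
    proof (rule odd_between_cong)
      fix t assume t: "\<theta> + a \<le> t" "t < u"
      show "(i, cis t) \<in> C' \<longleftrightarrow> (i, cis t) \<in> C"
      proof (cases "t = \<theta> + a")
        case True
        then show ?thesis using stop \<theta> by (simp add: cis_mult)
      next
        case False
        then show ?thesis using outside[of t] out t u by auto
      qed
    qed
    then show ?thesis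
      using odd_between_split[OF C(1), of \<theta> "\<theta> + a" u i] odd_between_split[OF C'(1), of \<theta> "\<theta> + a" u i]
        u a on_arc stop parity by auto
  qed
  \<comment> \<open>A full turn returns to the same label, so the old count is even; by
    \<open>agree\<close>, so is the new one.\<close>
  have "\<not> odd_between C i \<theta> (\<theta> + 2 * pi)"
    using alternatingD[OF alt i, of \<theta> "\<theta> + 2 * pi"] cis_add_2pi_nat[of \<theta> 1] by auto
  then have "even (card {x \<in> C'. fst x = i})"
    using agree[of "\<theta> + 2 * pi"] a odd_between_circle[OF C'(2), of i \<theta>] by simp
  then obtain \<phi> where \<phi>: "\<phi> (cis \<theta>) = \<kappa> (i, z)"
    "\<And>s s'. s \<le> s' \<Longrightarrow> \<phi> (cis s') = (\<phi> (cis s) \<noteq> odd_between C' i s s')"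
    using alternating_on_circle_exists[OF C', where \<theta> = \<theta> and b = "\<kappa> (i, z)"] by blast
  define \<kappa>' where "\<kappa>' x = (if fst x = i then \<phi> (snd x) else \<kappa> x)" for x
  show ?thesis
  proof
    show "\<kappa>' (along \<alpha> 0) = \<kappa> (along \<alpha> 0)"
      using \<phi>(1) \<theta> by (simp add: \<kappa>'_def)
    show "alternating n C' \<kappa>'"
      unfolding alternating_def
    proof (intro allI impI)
      fix j and s s' :: real assume j: "j < n" and le: "s \<le> s'"
      show "\<kappa>' (j, cis s') = (\<kappa>' (j, cis s) \<noteq> odd_between C' j s s')"
      proof (cases "j = i")
        case True
        then show ?thesis using \<phi>(2)[OF le] by (simp add: \<kappa>'_def)
      next
        case False
        then have "odd_between C' j s s' \<longleftrightarrow> odd_between C j s s'"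
          by (intro odd_between_cong) (use out in \<open>auto simp: arc_set_def\<close>)
        then show ?thesis using False alternatingD[OF alt j le] by (simp add: \<kappa>'_def)
      qed
    qed
    fix x :: "nat \<times> complex" assume x: "x \<in> UNIV \<times> sphere 0 1" "x \<notin> arc_set \<alpha>"
    show "\<kappa>' x = \<kappa> x"
    proof (cases "fst x = i")
      case True
      have "snd x \<in> sphere 0 1" using x(1) by auto
      then obtain u where u: "\<theta> \<le> u" "u < \<theta> + 2 * pi" "snd x = cis u"
        by (rule sphere_cis_from)
      have x_eq: "x = (i, cis u)" using True u(3) by (auto simp: prod_eq_iff)
      have "\<theta> + a \<le> u"
      proof (rule ccontr)
        assume "\<not> ?thesis"
        then have "x = along \<alpha> (u - \<theta>)" "u - \<theta> \<in> arc_params \<alpha>"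
          using u x_eq \<theta> by (auto simp: cis_mult)
        then show False using x(2) unfolding arc_set_def by blast
      qed
      then show ?thesis
        using agree[of u] u(1,2) \<phi>(2)[OF u(1)] \<phi>(1) alternatingD[OF alt i u(1)] \<theta> x_eq
        by (simp add: \<kappa>'_def)
    qed (simp add: \<kappa>'_def)
  qed
qed

text \<open>The arcs are replaced one at a time; \<open>C1\<close> is the stage at which only
  \<alpha> has been changed. Disjointness protects the crossings and the starting labels of the
  other arcs.\<close>

lemma alternating_replace_arcs:
  assumes "finite A" "alternating n C \<kappa>"
    and C: "finite C" "C \<subseteq> UNIV \<times> sphere 0 1" and C': "finite C'" "C' \<subseteq> UNIV \<times> sphere 0 1"
    and "\<And>\<alpha>. \<alpha> \<in> A \<Longrightarrow> proper_arc n \<alpha>"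
    and "\<And>\<alpha> \<beta>. \<alpha> \<in> A \<Longrightarrow> \<beta> \<in> A \<Longrightarrow> \<alpha> \<noteq> \<beta> \<Longrightarrow> arc_set \<alpha> \<inter> arc_set \<beta> = {}"
    and "\<And>x. x \<notin> (\<Union>\<alpha>\<in>A. arc_set \<alpha>) \<Longrightarrow> x \<in> C \<longleftrightarrow> x \<in> C'"
    and "\<And>\<alpha>. \<alpha> \<in> A \<Longrightarrow> odd (card (crossings_on C \<alpha>)) \<longleftrightarrow> odd (card (crossings_on C' \<alpha>))"
    and "\<And>\<alpha>. \<alpha> \<in> A \<Longrightarrow> along \<alpha> (arc_length \<alpha>) \<notin> C \<union> C'"
  shows "\<exists>\<kappa>'. alternating n C' \<kappa>' \<and> (\<forall>\<alpha>\<in>A. \<kappa>' (along \<alpha> 0) = \<kappa> (along \<alpha> 0)) \<and>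
    (\<forall>x \<in> UNIV \<times> sphere 0 1 - (\<Union>\<alpha>\<in>A. arc_set \<alpha>). \<kappa>' x = \<kappa> x)"
  using assms(1,2) C assms(7-)
proof (induction A arbitrary: C \<kappa> rule: finite_induct)
  case empty
  then have "C = C'" by auto
  with empty show ?case by auto
next
  case (insert \<alpha> B)
  note alt = insert.prems(1) and fin = insert.prems(2) and sph = insert.prems(3)
    and proper = insert.prems(4) and disj = insert.prems(5) and out = insert.prems(6)
    and parity = insert.prems(7) and stop = insert.prems(8)
  define C1 where "C1 = (C - arc_set \<alpha>) \<union> (C' \<inter> arc_set \<alpha>)"
  have C1: "finite C1" "C1 \<subseteq> UNIV \<times> sphere 0 1"
    unfolding C1_def using fin sph C' by auto
  have start_in: "along \<beta> 0 \<in> arc_set \<beta>" if "\<beta> \<in> insert \<alpha> B" for \<beta>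
    using proper[OF that] by (cases \<beta>) (auto simp: arc_set_def intro!: image_eqI[of _ _ 0])
  have stop_in: "along \<beta> (arc_length \<beta>) \<in> arc_set \<beta>" if "\<beta> \<in> insert \<alpha> B" for \<beta>
    using proper[OF that] by (cases \<beta>) (auto simp: arc_set_def)
  have cr\<alpha>: "crossings_on C1 \<alpha> = crossings_on C' \<alpha>"
    by (auto simp: crossings_on_def C1_def arc_set_def)
  have disj': "arc_set \<alpha> \<inter> arc_set \<beta> = {}" if "\<beta> \<in> B" for \<beta>
    using disj[of \<alpha> \<beta>] that insert.hyps by auto
  have cr: "crossings_on C1 \<beta> = crossings_on C \<beta>" if "\<beta> \<in> B" for \<beta>
    using disj'[OF that] by (fastforce simp: crossings_on_def C1_def arc_set_def)
  obtain \<kappa>1 where \<kappa>1: "alternating n C1 \<kappa>1" "\<kappa>1 (along \<alpha> 0) = \<kappa> (along \<alpha> 0)"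
    "\<And>x. x \<in> UNIV \<times> sphere 0 1 \<Longrightarrow> x \<notin> arc_set \<alpha> \<Longrightarrow> \<kappa>1 x = \<kappa> x"
  proof (rule alternating_replace_arc[OF alt fin sph C1])
    show "proper_arc n \<alpha>" using proper by simp
    show "x \<in> C \<longleftrightarrow> x \<in> C1" if "x \<notin> arc_set \<alpha>" for x using that by (simp add: C1_def)
    show "odd (card (crossings_on C \<alpha>)) \<longleftrightarrow> odd (card (crossings_on C1 \<alpha>))"
      using parity[of \<alpha>] by (simp add: cr\<alpha>)
    show "along \<alpha> (arc_length \<alpha>) \<notin> C" "along \<alpha> (arc_length \<alpha>) \<notin> C1"
      using stop[of \<alpha>] by (auto simp: C1_def)
  qed blast
  have "\<exists>\<kappa>'. alternating n C' \<kappa>' \<and> (\<forall>\<beta>\<in>B. \<kappa>' (along \<beta> 0) = \<kappa>1 (along \<beta> 0)) \<and>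
    (\<forall>x \<in> UNIV \<times> sphere 0 1 - (\<Union>\<beta>\<in>B. arc_set \<beta>). \<kappa>' x = \<kappa>1 x)"
  proof (rule insert.IH[OF \<kappa>1(1) C1])
    show "proper_arc n \<beta>" if "\<beta> \<in> B" for \<beta> using proper that by simp
    show "arc_set \<beta> \<inter> arc_set \<gamma> = {}" if "\<beta> \<in> B" "\<gamma> \<in> B" "\<beta> \<noteq> \<gamma>" for \<beta> \<gamma>
      using disj that by simp
    show "x \<in> C1 \<longleftrightarrow> x \<in> C'" if "x \<notin> (\<Union>\<beta>\<in>B. arc_set \<beta>)" for x
      using out[of x] that by (auto simp: C1_def)
    show "odd (card (crossings_on C1 \<beta>)) \<longleftrightarrow> odd (card (crossings_on C' \<beta>))" if "\<beta> \<in> B" for \<beta>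
      using parity[of \<beta>] cr[OF that] that by simp
    show "along \<beta> (arc_length \<beta>) \<notin> C1 \<union> C'" if "\<beta> \<in> B" for \<beta>
      using stop[of \<beta>] stop_in[of \<beta>] disj'[OF that] that by (auto simp: C1_def)
  qed
  then obtain \<kappa>' where \<kappa>': "alternating n C' \<kappa>'" "\<forall>\<beta>\<in>B. \<kappa>' (along \<beta> 0) = \<kappa>1 (along \<beta> 0)"
    "\<forall>x \<in> UNIV \<times> sphere 0 1 - (\<Union>\<beta>\<in>B. arc_set \<beta>). \<kappa>' x = \<kappa>1 x" by blast
  have sph_start: "along \<beta> 0 \<in> UNIV \<times> sphere 0 1" if "\<beta> \<in> insert \<alpha> B" for \<beta>
    using proper_arc_along_in_circles[OF proper[OF that], of 0] by auto
  have "\<kappa>' (along \<beta> 0) = \<kappa> (along \<beta> 0)" if "\<beta> \<in> insert \<alpha> B" for \<beta>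
  proof (cases "\<beta> = \<alpha>")
    case True
    have "along \<alpha> 0 \<notin> (\<Union>\<beta>\<in>B. arc_set \<beta>)" using start_in[of \<alpha>] disj' by auto
    then show ?thesis using True \<kappa>'(3) \<kappa>1(2) sph_start[of \<alpha>] by auto
  next
    case False
    then have "\<beta> \<in> B" using that by simp
    moreover from this have "along \<beta> 0 \<notin> arc_set \<alpha>" using start_in[OF that] disj' by blast
    ultimately
    show ?thesis using \<kappa>'(2) \<kappa>1(3) sph_start[OF that] by auto
  qed
  then show ?case using \<kappa>' \<kappa>1(3) by (intro exI[of _ \<kappa>']) auto
qed

section \<open>The parity projection\<close>

lemma double_pair_sym: "double_pair D x y \<Longrightarrow> double_pair D y x"
  unfolding double_pair_def by auto

lemma classical_pair_sym: "classical_pair D x y \<Longrightarrow> classical_pair D y x"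
  unfolding classical_pair_def using double_pair_sym by blast

lemma double_pair_unique:
  "virtual_link_diagram D \<Longrightarrow> double_pair D x y \<Longrightarrow> double_pair D x z \<Longrightarrow> y = z"
  unfolding virtual_link_diagram_def generic_immersion_def by blast

lemma over_in_circles: "virtual_link_diagram D \<Longrightarrow> x \<in> over D \<Longrightarrow> x \<in> circles D"
  unfolding virtual_link_diagram_def double_pair_def by blast

lemma classical_points_in_circles: "classical_points D \<subseteq> circles D"
  unfolding classical_points_def classical_pair_def double_pair_def by blast

lemma classical_points_sphere: "classical_points D \<subseteq> UNIV \<times> sphere 0 1"
  using classical_points_in_circles unfolding circles_def by fast

lemma finite_classical_points:
  assumes "virtual_link_diagram D"
  shows "finite (classical_points D)"
proof -
  have "finite {x. \<exists>y. double_pair D x y}"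
    using assms unfolding virtual_link_diagram_def generic_immersion_def by blast
  then show ?thesis
    by (rule rev_finite_subset) (auto simp: classical_points_def classical_pair_def)
qed

abbreviation labelling :: "vdiagram \<Rightarrow> (nat \<times> complex \<Rightarrow> bool) \<Rightarrow> bool" where
  "labelling D \<equiv> alternating (ncomp D) (classical_points D)"

text \<open>In a diagram there is at most one such \<open>y\<close>, the other preimage of the
  double point. At a classical crossing the labels compared are those of the two incoming
  arcs.\<close>

definition even_at :: "vdiagram \<Rightarrow> (nat \<times> complex \<Rightarrow> bool) \<Rightarrow> nat \<times> complex \<Rightarrow> bool" where
  "even_at D \<kappa> x \<longleftrightarrow> (\<exists>y. double_pair D x y \<and> \<kappa> x \<noteq> \<kappa> y)"

text \<open>Deleting a point from \<open>over\<close> makes its crossing virtual, because the other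
  preimage of a classical crossing is not in \<open>over\<close>.\<close>

definition project :: "(nat \<times> complex \<Rightarrow> bool) \<Rightarrow> vdiagram \<Rightarrow> vdiagram" where
  "project \<kappa> D = D\<lparr>over := {x \<in> over D. even_at D \<kappa> x}\<rparr>"

lemma project_simps [simp]:
  "ncomp (project \<kappa> D) = ncomp D"
  "strand (project \<kappa> D) = strand D"
  "over (project \<kappa> D) = {x \<in> over D. even_at D \<kappa> x}"
  by (simp_all add: project_def)

lemma project_geometry [simp]:
  "circles (project \<kappa> D) = circles D"
  "pos (project \<kappa> D) = pos D"
  "velocity (project \<kappa> D) = velocity D"
  "double_pair (project \<kappa> D) = double_pair D"
  "meet (project \<kappa> D) = meet D"
  by (simp_all add: fun_eq_iff circles_def pos_def velocity_def double_pair_def meet_def)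

lemma even_at_iff:
  "virtual_link_diagram D \<Longrightarrow> double_pair D x y \<Longrightarrow> even_at D \<kappa> x \<longleftrightarrow> \<kappa> x \<noteq> \<kappa> y"
  unfolding even_at_def using double_pair_unique by blast

lemma virtual_link_diagram_project:
  assumes "virtual_link_diagram D"
  shows "virtual_link_diagram (project \<kappa> D)"
proof -
  have "generic_immersion (project \<kappa> D) = generic_immersion D"
    by (simp only: generic_immersion_def project_simps project_geometry)
  moreover have "\<exists>y. double_pair D x y \<and> y \<notin> over (project \<kappa> D)" if "x \<in> over (project \<kappa> D)" for x
  proof -
    obtain y where "double_pair D x y" "y \<notin> over D"
      using assms \<open>x \<in> over (project \<kappa> D)\<close> unfolding virtual_link_diagram_def by auto
    then show ?thesis unfolding project_simps by blast
  qed
  ultimately show ?thesis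
    using assms unfolding virtual_link_diagram_def project_geometry by blast
qed

lemma classical_pair_project:
  assumes "virtual_link_diagram D"
  shows "classical_pair (project \<kappa> D) x y \<longleftrightarrow> classical_pair D x y \<and> \<kappa> x \<noteq> \<kappa> y"
  unfolding classical_pair_def
  using even_at_iff[OF assms, of x y \<kappa>] even_at_iff[OF assms, of y x \<kappa>] double_pair_sym[of D x y]
  by auto

lemma tangle_replacement_sym: "tangle_replacement A D E \<Longrightarrow> tangle_replacement A E D"
  unfolding tangle_replacement_def circles_def by auto

text \<open>The curves stay the same, so only the over points outside the disc have to be
  compared.\<close>

lemma tangle_replacement_project:
  assumes tr: "tangle_replacement A D E"
    and out: "\<And>x. x \<in> circles D - (\<Union>\<alpha>\<in>A. arc_set \<alpha>) \<Longrightarrow> even_at D \<kappa> x \<longleftrightarrow> even_at E \<kappa>' x"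
  shows "tangle_replacement A (project \<kappa> D) (project \<kappa>' E)"
  using tr out unfolding tangle_replacement_def tangle_in_disc_def
  by (auto simp: virtual_link_diagram_project)

section \<open>Geometry of a tangle in its disc\<close>

context
  fixes A D E
  assumes tr: "tangle_replacement A D E"
begin

lemma tangle_proper_arc:
  assumes "\<alpha> \<in> A" shows "proper_arc (ncomp D) \<alpha>"
proof -
  obtain c r where "tangle_in_disc c r A D"
    using tr unfolding tangle_replacement_def by blast
  with assms show ?thesis
    unfolding tangle_in_disc_def circles_def by (cases \<alpha>) auto
qed

text \<open>Being on the tangle becomes a condition on the position in the plane, which the two
  preimages of a double point share.\<close>

lemma tangle_cball_iff:
  assumes "tangle_in_disc c r A D" "x \<in> circles D"
  shows "pos D x \<in> cball c r \<longleftrightarrow> x \<in> (\<Union>\<alpha>\<in>A. arc_set \<alpha>)"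
proof
  show "x \<in> (\<Union>\<alpha>\<in>A. arc_set \<alpha>)" if "pos D x \<in> cball c r"
    using assms that unfolding tangle_in_disc_def by blast
  assume "x \<in> (\<Union>\<alpha>\<in>A. arc_set \<alpha>)"
  then obtain i z a s where A: "(i, z, a) \<in> A" and s: "s \<in> {0..a}" "x = (i, z * cis s)"
    unfolding arc_set_def by force
  have "pos D (i, z) \<in> sphere c r" "pos D (i, z * cis a) \<in> sphere c r"
    "\<forall>s\<in>{0<..<a}. pos D (i, z * cis s) \<in> ball c r"
    using assms(1) A unfolding tangle_in_disc_def by auto
  then have ends: "pos D (i, z) \<in> cball c r" "pos D (i, z * cis a) \<in> cball c r"
    "\<And>s. 0 < s \<Longrightarrow> s < a \<Longrightarrow> pos D (i, z * cis s) \<in> cball c r"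
    by (auto simp: less_imp_le)
  show "pos D x \<in> cball c r"
    using ends(1,2) ends(3)[of s] s by (cases "s = 0 \<or> s = a") auto
qed

lemma tangle_double_pair_iff:
  assumes "double_pair D x y"
  shows "x \<in> (\<Union>\<alpha>\<in>A. arc_set \<alpha>) \<longleftrightarrow> y \<in> (\<Union>\<alpha>\<in>A. arc_set \<alpha>)"
proof -
  obtain c r where td: "tangle_in_disc c r A D"
    using tr unfolding tangle_replacement_def by blast
  have "x \<in> circles D" "y \<in> circles D" "pos D x = pos D y"
    using assms by (auto simp: double_pair_def)
  then show ?thesis using tangle_cball_iff[OF td, of x] tangle_cball_iff[OF td, of y] by simp
qed

text \<open>The ends of the strands lie on the boundary of the disc, which carries no double points.
  This supplies the end-point condition of \<open>alternating_replace_arcs\<close>.\<close>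

lemma tangle_stop_not_double:
  assumes "\<alpha> \<in> A" shows "\<not> double_pair D (along \<alpha> (arc_length \<alpha>)) y"
proof -
  obtain c r where td: "tangle_in_disc c r A D"
    using tr unfolding tangle_replacement_def by blast
  obtain i z a where \<alpha>: "\<alpha> = (i, z, a)" by (cases \<alpha>)
  have "pos D (along \<alpha> (arc_length \<alpha>)) \<in> sphere c r"
    using td assms \<alpha> unfolding tangle_in_disc_def by auto
  moreover have "\<forall>x y. double_pair D x y \<longrightarrow> pos D x \<notin> sphere c r"
    using td unfolding tangle_in_disc_def by blast
  ultimately show ?thesis by blast
qed

lemma tangle_disjoint:
  "\<alpha> \<in> A \<Longrightarrow> \<beta> \<in> A \<Longrightarrow> \<alpha> \<noteq> \<beta> \<Longrightarrow> arc_set \<alpha> \<inter> arc_set \<beta> = {}"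
  using tr unfolding tangle_replacement_def tangle_in_disc_def by blast

lemma tangle_double_pair_outside:
  assumes "double_pair D x y" "x \<notin> (\<Union>\<alpha>\<in>A. arc_set \<alpha>)"
  shows "double_pair E x y"
proof -
  have x: "x \<in> circles D - (\<Union>\<alpha>\<in>A. arc_set \<alpha>)" and y: "y \<in> circles D - (\<Union>\<alpha>\<in>A. arc_set \<alpha>)"
    using assms tangle_double_pair_iff[OF assms(1)] by (auto simp: double_pair_def)
  have "pos D x = pos E x" "pos D y = pos E y" "circles D = circles E"
    using tr x y unfolding tangle_replacement_def circles_def by auto
  then show ?thesis using assms(1) by (simp add: double_pair_def)
qed

lemma tangle_over_outside:
  assumes "x \<notin> (\<Union>\<alpha>\<in>A. arc_set \<alpha>)"
  shows "x \<in> over D \<longleftrightarrow> x \<in> over E"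
proof -
  have "virtual_link_diagram D" "virtual_link_diagram E" "circles D = circles E"
    using tr unfolding tangle_replacement_def circles_def by auto
  \<comment> \<open>The replacement compares over points on the circles; off the circles neither
    diagram has any.\<close>
  then have "x \<notin> circles D \<Longrightarrow> x \<notin> over D \<and> x \<notin> over E"
    using over_in_circles by blast
  then show ?thesis using tr assms unfolding tangle_replacement_def by blast
qed

lemma tangle_classical_outside:
  assumes "classical_pair D x y" "x \<notin> (\<Union>\<alpha>\<in>A. arc_set \<alpha>)"
  shows "classical_pair E x y"
proof -
  have d: "double_pair D x y" using assms(1) unfolding classical_pair_def by blast
  then have "y \<notin> (\<Union>\<alpha>\<in>A. arc_set \<alpha>)" using assms(2) tangle_double_pair_iff by blast
  then show ?thesis
    using assms tangle_over_outside tangle_double_pair_outside[OF d] unfolding classical_pair_def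
    by blast
qed

text \<open>The partner of a crossing point on the tangle is again on the tangle, so the classical
  points of a strand can be read off the sets \<open>meet\<close>.\<close>

lemma tangle_crossings_on:
  assumes "\<alpha> \<in> A"
  shows "crossings_on (classical_points D) \<alpha> =
    {s. \<exists>\<beta>\<in>A. \<exists>t. (s, t) \<in> meet D \<alpha> \<beta> \<and> (is_over D \<alpha> s \<or> is_over D \<beta> t)}"
proof (intro subset_antisym subsetI)
  fix s assume s: "s \<in> crossings_on (classical_points D) \<alpha>"
  then obtain y where y: "classical_pair D (along \<alpha> s) y"
    unfolding crossings_on_def classical_points_def by blast
  have "along \<alpha> s \<in> (\<Union>\<alpha>\<in>A. arc_set \<alpha>)"
    using s assms unfolding crossings_on_def arc_set_def by blast
  then have "y \<in> (\<Union>\<alpha>\<in>A. arc_set \<alpha>)"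
    using y tangle_double_pair_iff unfolding classical_pair_def by blast
  then obtain \<beta> t where "\<beta> \<in> A" "t \<in> arc_params \<beta>" "y = along \<beta> t"
    unfolding arc_set_def by blast
  then show "s \<in> {s. \<exists>\<beta>\<in>A. \<exists>t. (s, t) \<in> meet D \<alpha> \<beta> \<and> (is_over D \<alpha> s \<or> is_over D \<beta> t)}"
    using s y unfolding meet_def is_over_def crossings_on_def classical_pair_def by blast
next
  fix s assume "s \<in> {s. \<exists>\<beta>\<in>A. \<exists>t. (s, t) \<in> meet D \<alpha> \<beta> \<and> (is_over D \<alpha> s \<or> is_over D \<beta> t)}"
  then show "s \<in> crossings_on (classical_points D) \<alpha>"
    unfolding crossings_on_def classical_points_def classical_pair_def meet_def is_over_def by blast
qed

end

section \<open>Carrying labels across a tangle replacement\<close>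

lemma tangle_labelling_exists:
  assumes tr: "tangle_replacement A D E" and A: "finite A" and lab: "labelling D \<kappa>"
    and parity: "\<And>\<alpha>. \<alpha> \<in> A \<Longrightarrow> odd (card (crossings_on (classical_points D) \<alpha>)) \<longleftrightarrow>
      odd (card (crossings_on (classical_points E) \<alpha>))"
  shows "\<exists>\<kappa>'. labelling E \<kappa>' \<and> (\<forall>\<alpha>\<in>A. \<kappa>' (along \<alpha> 0) = \<kappa> (along \<alpha> 0)) \<and>
    (\<forall>x \<in> UNIV \<times> sphere 0 1 - (\<Union>\<alpha>\<in>A. arc_set \<alpha>). \<kappa>' x = \<kappa> x)"
proof -
  note tr' = tangle_replacement_sym[OF tr]
  have D: "virtual_link_diagram D" and E: "virtual_link_diagram E" and n: "ncomp D = ncomp E"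
    using tr unfolding tangle_replacement_def by auto
  show ?thesis
    unfolding n[symmetric]
  proof (rule alternating_replace_arcs[OF A lab finite_classical_points[OF D] classical_points_sphere
        finite_classical_points[OF E] classical_points_sphere])
    show "x \<in> classical_points D \<longleftrightarrow> x \<in> classical_points E" if "x \<notin> (\<Union>\<alpha>\<in>A. arc_set \<alpha>)" for x
      using tangle_classical_outside[OF tr] tangle_classical_outside[OF tr'] that
      unfolding classical_points_def by blast
    show "along \<alpha> (arc_length \<alpha>) \<notin> classical_points D \<union> classical_points E" if "\<alpha> \<in> A" for \<alpha>
      using tangle_stop_not_double[OF tr that] tangle_stop_not_double[OF tr' that]
      unfolding classical_points_def classical_pair_def by blast
  qed (use tangle_proper_arc[OF tr] tangle_disjoint[OF tr] parity in blast)+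
qed

text \<open>
  The two directions are needed because equivalence uses the symmetric closure of the moves, and it is
  not clear that the relation \<^const>\<open>isotopic\<close> is symmetric.
\<close>

definition transports :: "(vdiagram \<Rightarrow> vdiagram \<Rightarrow> bool) \<Rightarrow> vdiagram \<Rightarrow> vdiagram \<Rightarrow> bool" where
  "transports M D E \<longleftrightarrow>
     (\<forall>\<kappa>. labelling D \<kappa> \<longrightarrow> (\<exists>\<kappa>'. labelling E \<kappa>' \<and> M (project \<kappa> D) (project \<kappa>' E))) \<and>
     (\<forall>\<kappa>'. labelling E \<kappa>' \<longrightarrow> (\<exists>\<kappa>. labelling D \<kappa> \<and> M (project \<kappa> D) (project \<kappa>' E)))"

text \<open>This leaves two local checks for each move: the parity of the crossings on every strand,
  and that the projected tangles are again related by a move if the labels agree at the starts of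
  the strands. Outside the disc, both the labels and the double points are unchanged, and so are the
  parities of the crossings.\<close>

lemma tangle_transports:
  assumes tr: "tangle_replacement A D E" and A: "finite A"
    and parity: "\<And>\<alpha>. \<alpha> \<in> A \<Longrightarrow> odd (card (crossings_on (classical_points D) \<alpha>)) \<longleftrightarrow>
      odd (card (crossings_on (classical_points E) \<alpha>))"
    and M: "\<And>\<kappa> \<kappa>'. labelling D \<kappa> \<Longrightarrow> labelling E \<kappa>' \<Longrightarrow>
      (\<And>\<alpha>. \<alpha> \<in> A \<Longrightarrow> \<kappa>' (along \<alpha> 0) = \<kappa> (along \<alpha> 0)) \<Longrightarrow>
      tangle_replacement A (project \<kappa> D) (project \<kappa>' E) \<Longrightarrow> M (project \<kappa> D) (project \<kappa>' E)"
  shows "transports M D E"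
proof -
  note tr' = tangle_replacement_sym[OF tr]
  have D: "virtual_link_diagram D" and E: "virtual_link_diagram E" and n: "ncomp D = ncomp E"
    using tr unfolding tangle_replacement_def by auto
  have proj: "tangle_replacement A (project \<kappa> D) (project \<kappa>' E)"
    if eq: "\<forall>x \<in> UNIV \<times> sphere 0 1 - (\<Union>\<alpha>\<in>A. arc_set \<alpha>). \<kappa>' x = \<kappa> x" for \<kappa> \<kappa>'
  proof (rule tangle_replacement_project[OF tr])
    fix x assume x: "x \<in> circles D - (\<Union>\<alpha>\<in>A. arc_set \<alpha>)"
    have agree: "\<kappa>' y = \<kappa> y" if "y \<in> circles D - (\<Union>\<alpha>\<in>A. arc_set \<alpha>)" for y
    proof -
      have "y \<in> UNIV \<times> sphere 0 1 - (\<Union>\<alpha>\<in>A. arc_set \<alpha>)"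
        using that by (auto simp: circles_def)
      with eq show ?thesis by blast
    qed
    have dp: "double_pair D x y \<longleftrightarrow> double_pair E x y" for y
      using tangle_double_pair_outside[OF tr] tangle_double_pair_outside[OF tr'] x by blast
    have "\<kappa>' y = \<kappa> y" if "double_pair D x y" for y
      using tangle_double_pair_iff[OF tr that] that x agree[of y] by (auto simp: double_pair_def)
    then show "even_at D \<kappa> x \<longleftrightarrow> even_at E \<kappa>' x"
      unfolding even_at_def using dp agree[OF x] by blast
  qed
  show ?thesis
    unfolding transports_def
  proof (intro conjI allI impI)
    fix \<kappa> assume lab: "labelling D \<kappa>"
    obtain \<kappa>' where \<kappa>': "labelling E \<kappa>'" "\<forall>\<alpha>\<in>A. \<kappa>' (along \<alpha> 0) = \<kappa> (along \<alpha> 0)"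
      "\<forall>x \<in> UNIV \<times> sphere 0 1 - (\<Union>\<alpha>\<in>A. arc_set \<alpha>). \<kappa>' x = \<kappa> x"
      using tangle_labelling_exists[OF tr A lab parity] by blast
    then show "\<exists>\<kappa>'. labelling E \<kappa>' \<and> M (project \<kappa> D) (project \<kappa>' E)"
      using M[OF lab \<kappa>'(1)] proj[OF \<kappa>'(3)] by blast
  next
    fix \<kappa>' assume lab: "labelling E \<kappa>'"
    obtain \<kappa> where \<kappa>: "labelling D \<kappa>" "\<forall>\<alpha>\<in>A. \<kappa> (along \<alpha> 0) = \<kappa>' (along \<alpha> 0)"
      "\<forall>x \<in> UNIV \<times> sphere 0 1 - (\<Union>\<alpha>\<in>A. arc_set \<alpha>). \<kappa> x = \<kappa>' x"
      using tangle_labelling_exists[OF tr' A lab] parity by blast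
    then have "\<forall>x \<in> UNIV \<times> sphere 0 1 - (\<Union>\<alpha>\<in>A. arc_set \<alpha>). \<kappa>' x = \<kappa> x" by auto
    then show "\<exists>\<kappa>. labelling D \<kappa> \<and> M (project \<kappa> D) (project \<kappa>' E)"
      using M[OF \<kappa>(1) lab] proj \<kappa>(1,2) by metis
  qed
qed

section \<open>Projection and Reidemeister moves\<close>

lemma meet_sym: "(s, t) \<in> meet D \<alpha> \<beta> \<longleftrightarrow> (t, s) \<in> meet D \<beta> \<alpha>"
  unfolding meet_def using double_pair_sym by blast

lemma meet_converse: "meet D \<beta> \<alpha> = (meet D \<alpha> \<beta>)\<inverse>"
  using meet_sym[of _ _ D \<alpha> \<beta>] by (auto simp del: split_paired_All)

text \<open>The form in which crossings on a strand of a move arise: \<open>P\<close> and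
  \<open>Q\<close> tell which of its two double points are classical.\<close>

lemma odd_card_two_points:
  assumes "s \<noteq> t"
  shows "odd (card {u. u = s \<and> P \<or> u = t \<and> Q}) \<longleftrightarrow> P \<noteq> Q"
proof -
  have "{u. u = s \<and> P \<or> u = t \<and> Q} = (if P then {s} else {}) \<union> (if Q then {t} else {})" by auto
  then show ?thesis using assms by auto
qed

text \<open>Of the two crossings, only the other one can come strictly before
  \<open>s\<close>.\<close>

lemma alternating_two_crossings:
  assumes "alternating n C \<kappa>" "proper_arc n \<alpha>" "s \<in> arc_params \<alpha>"
    and cr: "crossings_on C \<alpha> = {u. u = s \<and> P \<or> u = t \<and> Q}"
  shows "\<kappa> (along \<alpha> s) = (\<kappa> (along \<alpha> 0) \<noteq> (Q \<and> t < s))"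
proof -
  have "{u \<in> crossings_on C \<alpha>. u < s} = (if Q \<and> t < s then {t} else {})"
    unfolding cr by auto
  then show ?thesis using alternating_along[OF assms(1-3)] by (simp split: if_splits)
qed

lemma is_over_project:
  assumes "virtual_link_diagram D" "(s, t) \<in> meet D \<alpha> \<beta>"
  shows "is_over (project \<kappa> D) \<alpha> s \<longleftrightarrow> is_over D \<alpha> s \<and> \<kappa> (along \<alpha> s) \<noteq> \<kappa> (along \<beta> t)"
  using even_at_iff[OF assms(1), of "along \<alpha> s" "along \<beta> t" \<kappa>] assms(2)
  by (auto simp: is_over_def meet_def)

text \<open>With equal parameters, one point of \<alpha> would have partners on two disjoint
  arcs.\<close>

lemma meet_params_differ:
  assumes tr: "tangle_replacement A D E" and A: "\<beta> \<in> A" "\<gamma> \<in> A" and ne: "\<beta> \<noteq> \<gamma>"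
    and meets: "(s, t) \<in> meet D \<alpha> \<beta>" "(s', t') \<in> meet D \<alpha> \<gamma>"
  shows "s \<noteq> s'"
proof
  assume "s = s'"
  have "virtual_link_diagram D" using tr unfolding tangle_replacement_def by blast
  then have "along \<beta> t = along \<gamma> t'"
    using meets \<open>s = s'\<close> double_pair_unique unfolding meet_def by blast
  moreover have "along \<beta> t \<in> arc_set \<beta>" "along \<gamma> t' \<in> arc_set \<gamma>"
    using meets unfolding meet_def arc_set_def by auto
  ultimately show False using tangle_disjoint[OF tr A ne] by auto
qed

text \<open>The strand passes the crossing twice, so it gains zero or two classical points. As the
  move admits both kinds of crossings, the projected crossing may be of either parity.\<close>

lemma reidemeister1_transports:
  assumes "reidemeister1 D E"
  shows "transports reidemeister1 D E"
proof -
  obtain \<alpha> s t where tr: "tangle_replacement {\<alpha>} D E"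
    and mD: "meet D \<alpha> \<alpha> = {}" and mE: "meet E \<alpha> \<alpha> = {(s, t), (t, s)}"
    using assms unfolding reidemeister1_def by blast
  note tr' = tangle_replacement_sym[OF tr]
  have "(s, t) \<in> meet E \<alpha> \<alpha>" using mE by simp
  then have "s \<noteq> t" unfolding meet_def double_pair_def by auto
  show ?thesis
  proof (rule tangle_transports[OF tr])
    have "crossings_on (classical_points D) \<alpha> = {}"
      using tangle_crossings_on[OF tr] mD by simp
    moreover have "crossings_on (classical_points E) \<alpha> =
        {u. u = s \<and> (is_over E \<alpha> s \<or> is_over E \<alpha> t) \<or> u = t \<and> (is_over E \<alpha> s \<or> is_over E \<alpha> t)}"
      using tangle_crossings_on[OF tr', of \<alpha>] mE by auto
    ultimately show "odd (card (crossings_on (classical_points D) \<beta>)) \<longleftrightarrow>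
        odd (card (crossings_on (classical_points E) \<beta>))" if "\<beta> \<in> {\<alpha>}" for \<beta>
      using odd_card_two_points[OF \<open>s \<noteq> t\<close>] that by simp
    show "reidemeister1 (project \<kappa> D) (project \<kappa>' E)"
      if "tangle_replacement {\<alpha>} (project \<kappa> D) (project \<kappa>' E)" for \<kappa> \<kappa>'
      unfolding reidemeister1_def project_geometry using that mD mE by blast
  qed simp
qed

text \<open>If the crossings are classical, passing from one to the other negates the labels of both
  strands. So the two crossings have the same parity, and they are kept or made virtual
  together.\<close>

lemma reidemeister2_transports:
  assumes "reidemeister2 D E"
  shows "transports reidemeister2 D E"
proof -
  obtain \<alpha> \<beta> s1 t1 s2 t2 where ne: "\<alpha> \<noteq> \<beta>" and tr: "tangle_replacement {\<alpha>, \<beta>} D E"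
    and mD: "meet D \<alpha> \<alpha> = {}" "meet D \<beta> \<beta> = {}" "meet D \<alpha> \<beta> = {}"
    and mE: "meet E \<alpha> \<alpha> = {}" "meet E \<beta> \<beta> = {}" "meet E \<alpha> \<beta> = {(s1, t1), (s2, t2)}"
    and s: "s1 \<noteq> s2"
    and o: "is_over E \<alpha> s1 \<longleftrightarrow> is_over E \<alpha> s2" "is_over E \<beta> t1 \<longleftrightarrow> is_over E \<beta> t2"
    using assms unfolding reidemeister2_def by blast
  note tr' = tangle_replacement_sym[OF tr]
  have E: "virtual_link_diagram E" using tr unfolding tangle_replacement_def by blast
  have mD': "meet D \<beta> \<alpha> = {}" and mE': "meet E \<beta> \<alpha> = {(t1, s1), (t2, s2)}"
    using meet_converse[of D \<alpha> \<beta>] meet_converse[of E \<alpha> \<beta>] mD mE by auto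
  have m: "(s1, t1) \<in> meet E \<alpha> \<beta>" "(s2, t2) \<in> meet E \<alpha> \<beta>"
    "(t1, s1) \<in> meet E \<beta> \<alpha>" "(t2, s2) \<in> meet E \<beta> \<alpha>"
    using mE mE' by auto
  have params: "s1 \<in> arc_params \<alpha>" "s2 \<in> arc_params \<alpha>" "t1 \<in> arc_params \<beta>" "t2 \<in> arc_params \<beta>"
    using m unfolding meet_def by auto
  have proper: "proper_arc (ncomp E) \<alpha>" "proper_arc (ncomp E) \<beta>"
    using tangle_proper_arc[OF tr'] by auto
  have t: "t1 \<noteq> t2"
  proof
    assume "t1 = t2"
    then have "along \<alpha> s1 = along \<alpha> s2"
      using m(3,4) double_pair_unique[OF E] unfolding meet_def by blast
    then show False using proper_arc_along_inj[OF proper(1) params(1,2)] s by simp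
  qed
  \<comment> \<open>By \<open>o\<close>, this tells of both crossings at once whether they are
    classical.\<close>
  define P where "P \<longleftrightarrow> is_over E \<alpha> s1 \<or> is_over E \<beta> t1"
  have crD: "crossings_on (classical_points D) \<gamma> = {}" if "\<gamma> \<in> {\<alpha>, \<beta>}" for \<gamma>
    using tangle_crossings_on[OF tr that] mD mD' that by auto
  have crE: "crossings_on (classical_points E) \<alpha> = {u. u = s1 \<and> P \<or> u = s2 \<and> P}"
    "crossings_on (classical_points E) \<beta> = {u. u = t1 \<and> P \<or> u = t2 \<and> P}"
    using tangle_crossings_on[OF tr', of \<alpha>] tangle_crossings_on[OF tr', of \<beta>] mE mE' o
    unfolding P_def by auto
  then have crE': "crossings_on (classical_points E) \<alpha> = {u. u = s2 \<and> P \<or> u = s1 \<and> P}"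
    "crossings_on (classical_points E) \<beta> = {u. u = t2 \<and> P \<or> u = t1 \<and> P}"
    by auto
  show ?thesis
  proof (rule tangle_transports[OF tr])
    show "odd (card (crossings_on (classical_points D) \<gamma>)) \<longleftrightarrow>
        odd (card (crossings_on (classical_points E) \<gamma>))" if \<gamma>: "\<gamma> \<in> {\<alpha>, \<beta>}" for \<gamma>
    proof -
      have "even (card (crossings_on (classical_points E) \<alpha>))"
        "even (card (crossings_on (classical_points E) \<beta>))"
        using odd_card_two_points[OF s, of P P] odd_card_two_points[OF t, of P P] unfolding crE by blast+
      with \<gamma> crD[OF \<gamma>] show ?thesis by (elim insertE emptyE) simp_all
    qed
    fix \<kappa> \<kappa>' assume lab: "labelling E \<kappa>'"
      and tr'': "tangle_replacement {\<alpha>, \<beta>} (project \<kappa> D) (project \<kappa>' E)"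
    have eq1: "P \<Longrightarrow> \<kappa>' (along \<alpha> s1) = (\<not> \<kappa>' (along \<alpha> s2))"
      using alternating_two_crossings[OF lab proper(1) params(1) crE(1)]
        alternating_two_crossings[OF lab proper(1) params(2) crE'(1)] s by auto
    have eq2: "P \<Longrightarrow> \<kappa>' (along \<beta> t1) = (\<not> \<kappa>' (along \<beta> t2))"
      using alternating_two_crossings[OF lab proper(2) params(3) crE(2)]
        alternating_two_crossings[OF lab proper(2) params(4) crE'(2)] t by auto
    have "is_over (project \<kappa>' E) \<alpha> s1 \<longleftrightarrow> is_over (project \<kappa>' E) \<alpha> s2"
      "is_over (project \<kappa>' E) \<beta> t1 \<longleftrightarrow> is_over (project \<kappa>' E) \<beta> t2"
      using is_over_project[OF E m(1), of \<kappa>'] is_over_project[OF E m(2), of \<kappa>']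
        is_over_project[OF E m(3), of \<kappa>'] is_over_project[OF E m(4), of \<kappa>'] o eq1 eq2
      unfolding P_def by auto
    then show "reidemeister2 (project \<kappa> D) (project \<kappa>' E)"
      unfolding reidemeister2_def
      by (intro exI[of _ \<alpha>] exI[of _ \<beta>] exI[of _ s1] exI[of _ t1] exI[of _ s2] exI[of _ t2])
        (simp add: ne tr'' mD mE s)
  qed simp
qed

section \<open>The third move\<close>

lemma triangle_swap12:
  "triangle D \<alpha> \<beta> \<gamma> (a1, a2) (b1, b2) (c1, c2) \<Longrightarrow> triangle D \<beta> \<alpha> \<gamma> (b1, b2) (a1, a2) (c2, c1)"
  unfolding triangle_def using meet_converse[of D \<alpha> \<beta>] by auto

text \<open>Together with \<open>triangle_swap12\<close>, this allows any of the strands to be named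
  first, which is the role of the strand with two virtual crossings in a mixed move.\<close>

lemma triangle_swap23:
  "triangle D \<alpha> \<beta> \<gamma> (a1, a2) (b1, b2) (c1, c2) \<Longrightarrow> triangle D \<alpha> \<gamma> \<beta> (a2, a1) (c1, c2) (b1, b2)"
  unfolding triangle_def using meet_converse[of D \<beta> \<gamma>] by auto

context
  fixes D E \<alpha> \<beta> \<gamma> a1 a2 b1 b2 c1 c2
  assumes ne: "\<alpha> \<noteq> \<beta>" "\<alpha> \<noteq> \<gamma>" "\<beta> \<noteq> \<gamma>"
    and tr: "tangle_replacement {\<alpha>, \<beta>, \<gamma>} D E"
    and tri: "triangle D \<alpha> \<beta> \<gamma> (a1, a2) (b1, b2) (c1, c2)"
begin

lemma triangle_meets:
  "(a1, b1) \<in> meet D \<alpha> \<beta>" "(a2, c1) \<in> meet D \<alpha> \<gamma>" "(b2, c2) \<in> meet D \<beta> \<gamma>"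
  "(b1, a1) \<in> meet D \<beta> \<alpha>" "(c1, a2) \<in> meet D \<gamma> \<alpha>" "(c2, b2) \<in> meet D \<gamma> \<beta>"
  using tri meet_converse[of D \<alpha> \<beta>] meet_converse[of D \<alpha> \<gamma>] meet_converse[of D \<beta> \<gamma>]
  unfolding triangle_def by auto

lemma triangle_params_differ: "a1 \<noteq> a2" "b1 \<noteq> b2" "c1 \<noteq> c2"
  using meet_params_differ[OF tr, of \<beta> \<gamma> a1 b1 \<alpha> a2 c1] meet_params_differ[OF tr, of \<alpha> \<gamma> b1 a1 \<beta> b2 c2]
    meet_params_differ[OF tr, of \<alpha> \<beta> c1 a2 \<gamma> c2 b2] triangle_meets ne by auto

text \<open>\<open>P\<close>, \<open>Q\<close> and \<open>R\<close> tell whether the crossings of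
  \<alpha> with \<beta>, of \<alpha> with \<gamma> and of \<beta> with \<gamma> are classical. They
  enter through equations so that the diagrams before and after the move can share them.\<close>

lemma triangle_crossings_on:
  assumes "P = (is_over D \<alpha> a1 \<or> is_over D \<beta> b1)" "Q = (is_over D \<alpha> a2 \<or> is_over D \<gamma> c1)"
    "R = (is_over D \<beta> b2 \<or> is_over D \<gamma> c2)"
  shows "crossings_on (classical_points D) \<alpha> = {u. u = a1 \<and> P \<or> u = a2 \<and> Q}"
    "crossings_on (classical_points D) \<beta> = {u. u = b1 \<and> P \<or> u = b2 \<and> R}"
    "crossings_on (classical_points D) \<gamma> = {u. u = c1 \<and> Q \<or> u = c2 \<and> R}"
proof -
  have m: "meet D \<beta> \<alpha> = {(b1, a1)}" "meet D \<gamma> \<alpha> = {(c1, a2)}" "meet D \<gamma> \<beta> = {(c2, b2)}"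
    "meet D \<alpha> \<beta> = {(a1, b1)}" "meet D \<alpha> \<gamma> = {(a2, c1)}" "meet D \<beta> \<gamma> = {(b2, c2)}"
    "meet D \<alpha> \<alpha> = {}" "meet D \<beta> \<beta> = {}" "meet D \<gamma> \<gamma> = {}"
    using tri meet_converse[of D \<alpha> \<beta>] meet_converse[of D \<alpha> \<gamma>] meet_converse[of D \<beta> \<gamma>]
    unfolding triangle_def by auto
  show "crossings_on (classical_points D) \<alpha> = {u. u = a1 \<and> P \<or> u = a2 \<and> Q}"
    using tangle_crossings_on[OF tr, of \<alpha>] assms by (auto simp: m)
  show "crossings_on (classical_points D) \<beta> = {u. u = b1 \<and> P \<or> u = b2 \<and> R}"
    using tangle_crossings_on[OF tr, of \<beta>] assms by (auto simp: m)
  show "crossings_on (classical_points D) \<gamma> = {u. u = c1 \<and> Q \<or> u = c2 \<and> R}"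
    using tangle_crossings_on[OF tr, of \<gamma>] assms by (auto simp: m)
qed

lemma triangle_labels:
  assumes lab: "labelling D \<kappa>"
    and "P = (is_over D \<alpha> a1 \<or> is_over D \<beta> b1)" "Q = (is_over D \<alpha> a2 \<or> is_over D \<gamma> c1)"
    "R = (is_over D \<beta> b2 \<or> is_over D \<gamma> c2)"
  shows "\<kappa> (along \<alpha> a1) = (\<kappa> (along \<alpha> 0) \<noteq> (Q \<and> a2 < a1))"
    "\<kappa> (along \<alpha> a2) = (\<kappa> (along \<alpha> 0) \<noteq> (P \<and> a1 < a2))"
    "\<kappa> (along \<beta> b1) = (\<kappa> (along \<beta> 0) \<noteq> (R \<and> b2 < b1))"
    "\<kappa> (along \<beta> b2) = (\<kappa> (along \<beta> 0) \<noteq> (P \<and> b1 < b2))"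
    "\<kappa> (along \<gamma> c1) = (\<kappa> (along \<gamma> 0) \<noteq> (R \<and> c2 < c1))"
    "\<kappa> (along \<gamma> c2) = (\<kappa> (along \<gamma> 0) \<noteq> (Q \<and> c1 < c2))"
proof -
  note cr = triangle_crossings_on[OF assms(2-)]
  have proper: "proper_arc (ncomp D) \<alpha>" "proper_arc (ncomp D) \<beta>" "proper_arc (ncomp D) \<gamma>"
    using tangle_proper_arc[OF tr] by auto
  have params: "a1 \<in> arc_params \<alpha>" "a2 \<in> arc_params \<alpha>" "b1 \<in> arc_params \<beta>" "b2 \<in> arc_params \<beta>"
    "c1 \<in> arc_params \<gamma>" "c2 \<in> arc_params \<gamma>"
    using triangle_meets unfolding meet_def by auto
  note two = alternating_two_crossings[OF lab]
  show "\<kappa> (along \<alpha> a1) = (\<kappa> (along \<alpha> 0) \<noteq> (Q \<and> a2 < a1))"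
    by (rule two[OF proper(1) params(1), of P]) (use cr in auto)
  show "\<kappa> (along \<alpha> a2) = (\<kappa> (along \<alpha> 0) \<noteq> (P \<and> a1 < a2))"
    by (rule two[OF proper(1) params(2), of Q]) (use cr in auto)
  show "\<kappa> (along \<beta> b1) = (\<kappa> (along \<beta> 0) \<noteq> (R \<and> b2 < b1))"
    by (rule two[OF proper(2) params(3), of P]) (use cr in auto)
  show "\<kappa> (along \<beta> b2) = (\<kappa> (along \<beta> 0) \<noteq> (P \<and> b1 < b2))"
    by (rule two[OF proper(2) params(4), of R]) (use cr in auto)
  show "\<kappa> (along \<gamma> c1) = (\<kappa> (along \<gamma> 0) \<noteq> (R \<and> c2 < c1))"
    by (rule two[OF proper(3) params(5), of Q]) (use cr in auto)
  show "\<kappa> (along \<gamma> c2) = (\<kappa> (along \<gamma> 0) \<noteq> (Q \<and> c1 < c2))"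
    by (rule two[OF proper(3) params(6), of R]) (use cr in auto)
qed

end

lemma reidemeister3I:
  assumes "\<alpha> \<noteq> \<beta>" "\<alpha> \<noteq> \<gamma>" "\<beta> \<noteq> \<gamma>" "tangle_replacement {\<alpha>, \<beta>, \<gamma>} D E"
    "triangle D \<alpha> \<beta> \<gamma> (a1, a2) (b1, b2) (c1, c2)"
    "triangle E \<alpha> \<beta> \<gamma> (a1', a2') (b1', b2') (c1', c2')"
    "a1 < a2 \<longleftrightarrow> a2' < a1'" "b1 < b2 \<longleftrightarrow> b2' < b1'" "c1 < c2 \<longleftrightarrow> c2' < c1'"
    "is_over D \<alpha> a1 \<longleftrightarrow> is_over E \<alpha> a1'" "is_over D \<alpha> a2 \<longleftrightarrow> is_over E \<alpha> a2'"
    "is_over D \<beta> b1 \<longleftrightarrow> is_over E \<beta> b1'" "is_over D \<beta> b2 \<longleftrightarrow> is_over E \<beta> b2'"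
    "is_over D \<gamma> c1 \<longleftrightarrow> is_over E \<gamma> c1'" "is_over D \<gamma> c2 \<longleftrightarrow> is_over E \<gamma> c2'"
    "is_over D \<alpha> a1 \<and> is_over D \<alpha> a2 \<and> is_over D \<beta> b2 \<or>
      \<not> is_over D \<alpha> a1 \<and> \<not> is_over D \<beta> b1 \<and> \<not> is_over D \<alpha> a2 \<and> \<not> is_over D \<gamma> c1"
  shows "reidemeister3 D E"
  unfolding reidemeister3_def
  by (rule exI[of _ \<alpha>], rule exI[of _ \<beta>], rule exI[of _ \<gamma>], rule exI[of _ a1], rule exI[of _ a2],
      rule exI[of _ b1], rule exI[of _ b2], rule exI[of _ c1], rule exI[of _ c2],
      rule exI[of _ a1'], rule exI[of _ a2'], rule exI[of _ b1'], rule exI[of _ b2'],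
      rule exI[of _ c1'], rule exI[of _ c2']) (intro conjI; fact)

lemma reidemeister3_transports:
  assumes "reidemeister3 D E"
  shows "transports reidemeister3 D E"
proof -
  obtain \<alpha> \<beta> \<gamma> a1 a2 b1 b2 c1 c2 a1' a2' b1' b2' c1' c2' where
    ne: "\<alpha> \<noteq> \<beta>" "\<alpha> \<noteq> \<gamma>" "\<beta> \<noteq> \<gamma>" and tr: "tangle_replacement {\<alpha>, \<beta>, \<gamma>} D E" and
    triD: "triangle D \<alpha> \<beta> \<gamma> (a1, a2) (b1, b2) (c1, c2)" and
    triE: "triangle E \<alpha> \<beta> \<gamma> (a1', a2') (b1', b2') (c1', c2')" and
    order: "a1 < a2 \<longleftrightarrow> a2' < a1'" "b1 < b2 \<longleftrightarrow> b2' < b1'" "c1 < c2 \<longleftrightarrow> c2' < c1'" and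
    kinds: "is_over D \<alpha> a1 \<longleftrightarrow> is_over E \<alpha> a1'" "is_over D \<alpha> a2 \<longleftrightarrow> is_over E \<alpha> a2'"
      "is_over D \<beta> b1 \<longleftrightarrow> is_over E \<beta> b1'" "is_over D \<beta> b2 \<longleftrightarrow> is_over E \<beta> b2'"
      "is_over D \<gamma> c1 \<longleftrightarrow> is_over E \<gamma> c1'" "is_over D \<gamma> c2 \<longleftrightarrow> is_over E \<gamma> c2'" and
    admissible: "is_over D \<alpha> a1 \<and> is_over D \<alpha> a2 \<and> is_over D \<beta> b2 \<or>
      \<not> is_over D \<alpha> a1 \<and> \<not> is_over D \<beta> b1 \<and> \<not> is_over D \<alpha> a2 \<and> \<not> is_over D \<gamma> c1"
    using assms unfolding reidemeister3_def by (elim exE conjE) (rule that)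
  note tr' = tangle_replacement_sym[OF tr]
  have D: "virtual_link_diagram D" and E: "virtual_link_diagram E"
    using tr unfolding tangle_replacement_def by auto
  define P where "P \<longleftrightarrow> is_over D \<alpha> a1 \<or> is_over D \<beta> b1"
  define Q where "Q \<longleftrightarrow> is_over D \<alpha> a2 \<or> is_over D \<gamma> c1"
  define R where "R \<longleftrightarrow> is_over D \<beta> b2 \<or> is_over D \<gamma> c2"
  have PQR: "P = (is_over E \<alpha> a1' \<or> is_over E \<beta> b1')" "Q = (is_over E \<alpha> a2' \<or> is_over E \<gamma> c1')"
    "R = (is_over E \<beta> b2' \<or> is_over E \<gamma> c2')"
    using kinds P_def Q_def R_def by auto
  note diff = triangle_params_differ[OF ne tr triD]
  note diff' = triangle_params_differ[OF ne tr' triE]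
  note m = triangle_meets[OF ne tr triD]
  note m' = triangle_meets[OF ne tr' triE]
  show ?thesis
  proof (rule tangle_transports[OF tr])
    show "odd (card (crossings_on (classical_points D) \<delta>)) \<longleftrightarrow>
        odd (card (crossings_on (classical_points E) \<delta>))" if "\<delta> \<in> {\<alpha>, \<beta>, \<gamma>}" for \<delta>
      using that
      by (elim insertE emptyE)
        (simp_all only: triangle_crossings_on[OF ne tr triD P_def Q_def R_def]
          triangle_crossings_on[OF ne tr' triE PQR]
          odd_card_two_points[OF diff(1)] odd_card_two_points[OF diff(2)]
          odd_card_two_points[OF diff(3)] odd_card_two_points[OF diff'(1)]
          odd_card_two_points[OF diff'(2)] odd_card_two_points[OF diff'(3)])
    fix \<kappa> \<kappa>' assume lab: "labelling D \<kappa>" "labelling E \<kappa>'"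
      and start: "\<And>\<delta>. \<delta> \<in> {\<alpha>, \<beta>, \<gamma>} \<Longrightarrow> \<kappa>' (along \<delta> 0) = \<kappa> (along \<delta> 0)"
      and tr'': "tangle_replacement {\<alpha>, \<beta>, \<gamma>} (project \<kappa> D) (project \<kappa>' E)"
    note L = triangle_labels[OF ne tr triD lab(1) P_def Q_def R_def]
    note L' = triangle_labels[OF ne tr' triE lab(2) PQR]
    define e12 where "e12 \<longleftrightarrow> \<kappa> (along \<alpha> a1) \<noteq> \<kappa> (along \<beta> b1)"
    define e13 where "e13 \<longleftrightarrow> \<kappa> (along \<alpha> a2) \<noteq> \<kappa> (along \<gamma> c1)"
    define e23 where "e23 \<longleftrightarrow> \<kappa> (along \<beta> b2) \<noteq> \<kappa> (along \<gamma> c2)"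
    \<comment> \<open>All comparisons are expressed by three truth values, one for the order along
      each strand; the claims about the labels then become propositional.\<close>
    have asym: "a2 < a1 \<longleftrightarrow> \<not> a1 < a2" "b2 < b1 \<longleftrightarrow> \<not> b1 < b2" "c2 < c1 \<longleftrightarrow> \<not> c1 < c2"
      "a2' < a1' \<longleftrightarrow> a1 < a2" "b2' < b1' \<longleftrightarrow> b1 < b2" "c2' < c1' \<longleftrightarrow> c1 < c2"
      "a1' < a2' \<longleftrightarrow> \<not> a1 < a2" "b1' < b2' \<longleftrightarrow> \<not> b1 < b2" "c1' < c2' \<longleftrightarrow> \<not> c1 < c2"
      using diff diff' order by auto
    have PQR_cases: "P \<and> Q \<and> R \<or> \<not> P \<and> \<not> Q" using admissible P_def Q_def R_def by blast
    have start': "\<kappa>' (along \<alpha> 0) = \<kappa> (along \<alpha> 0)" "\<kappa>' (along \<beta> 0) = \<kappa> (along \<beta> 0)"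
      "\<kappa>' (along \<gamma> 0) = \<kappa> (along \<gamma> 0)"
      using start by auto
    \<comment> \<open>If all crossings are classical, reversing the orders negates both labels at
      each crossing, so their difference survives. If \<alpha> has only virtual crossings, the
      labels of \<beta> and \<gamma> at their common crossing are the starting labels before and
      after the move.\<close>
    have e': "P \<Longrightarrow> \<kappa>' (along \<alpha> a1') \<noteq> \<kappa>' (along \<beta> b1') \<longleftrightarrow> e12"
      "Q \<Longrightarrow> \<kappa>' (along \<alpha> a2') \<noteq> \<kappa>' (along \<gamma> c1') \<longleftrightarrow> e13"
      "R \<Longrightarrow> \<kappa>' (along \<beta> b2') \<noteq> \<kappa>' (along \<gamma> c2') \<longleftrightarrow> e23"
      unfolding e12_def e13_def e23_def L L' start' asym using PQR_cases by auto
    \<comment> \<open>Each strand has different labels at its two crossings. Adding up over the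
      strands, an odd number of the three crossings is even, so none or two of them are odd.\<close>
    have odd_e: "P \<and> Q \<and> R \<Longrightarrow> (e12 \<longleftrightarrow> e13) \<longleftrightarrow> e23"
      unfolding e12_def e13_def e23_def L asym by auto
    have ovD: "is_over (project \<kappa> D) \<alpha> a1 \<longleftrightarrow> is_over D \<alpha> a1 \<and> e12"
      "is_over (project \<kappa> D) \<beta> b1 \<longleftrightarrow> is_over D \<beta> b1 \<and> e12"
      "is_over (project \<kappa> D) \<alpha> a2 \<longleftrightarrow> is_over D \<alpha> a2 \<and> e13"
      "is_over (project \<kappa> D) \<gamma> c1 \<longleftrightarrow> is_over D \<gamma> c1 \<and> e13"
      "is_over (project \<kappa> D) \<beta> b2 \<longleftrightarrow> is_over D \<beta> b2 \<and> e23"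
      "is_over (project \<kappa> D) \<gamma> c2 \<longleftrightarrow> is_over D \<gamma> c2 \<and> e23"
      unfolding e12_def e13_def e23_def using is_over_project[OF D] m by blast+
    have ovE1: "is_over (project \<kappa>' E) \<alpha> a1' \<longleftrightarrow> is_over D \<alpha> a1 \<and> e12"
      unfolding is_over_project[OF E m'(1)] kinds(1)[symmetric] using e'(1) P_def by blast
    have ovE2: "is_over (project \<kappa>' E) \<beta> b1' \<longleftrightarrow> is_over D \<beta> b1 \<and> e12"
      unfolding is_over_project[OF E m'(4)] kinds(3)[symmetric] using e'(1) P_def by blast
    have ovE3: "is_over (project \<kappa>' E) \<alpha> a2' \<longleftrightarrow> is_over D \<alpha> a2 \<and> e13"
      unfolding is_over_project[OF E m'(2)] kinds(2)[symmetric] using e'(2) Q_def by blast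
    have ovE4: "is_over (project \<kappa>' E) \<gamma> c1' \<longleftrightarrow> is_over D \<gamma> c1 \<and> e13"
      unfolding is_over_project[OF E m'(5)] kinds(5)[symmetric] using e'(2) Q_def by blast
    have ovE5: "is_over (project \<kappa>' E) \<beta> b2' \<longleftrightarrow> is_over D \<beta> b2 \<and> e23"
      unfolding is_over_project[OF E m'(3)] kinds(4)[symmetric] using e'(3) R_def by blast
    have ovE6: "is_over (project \<kappa>' E) \<gamma> c2' \<longleftrightarrow> is_over D \<gamma> c2 \<and> e23"
      unfolding is_over_project[OF E m'(6)] kinds(6)[symmetric] using e'(3) R_def by blast
    note ovE = ovE1 ovE2 ovE3 ovE4 ovE5 ovE6
    have triD': "triangle (project \<kappa> D) \<alpha> \<beta> \<gamma> (a1, a2) (b1, b2) (c1, c2)"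
      and triE': "triangle (project \<kappa>' E) \<alpha> \<beta> \<gamma> (a1', a2') (b1', b2') (c1', c2')"
      using triD triE by (simp_all add: triangle_def)
    have perm: "{\<beta>, \<alpha>, \<gamma>} = {\<alpha>, \<beta>, \<gamma>}" "{\<gamma>, \<alpha>, \<beta>} = {\<alpha>, \<beta>, \<gamma>}" by auto
    have adm: "P \<Longrightarrow> is_over D \<alpha> a1 \<and> is_over D \<alpha> a2 \<and> is_over D \<beta> b2"
      using admissible P_def by blast
    text \<open>
      Any two crossings of the triangle have a strand in common. So if two of them are odd, this strand
      becomes the one with virtual crossings in a mixed move.
    \<close>
    consider "P \<and> Q \<and> R \<and> e12 \<and> e13 \<and> e23" | "\<not> (P \<and> e12) \<and> \<not> (Q \<and> e13)"
      | "\<not> e12 \<and> \<not> e23" | "\<not> e13 \<and> \<not> e23"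
      using PQR_cases odd_e by blast
    then show "reidemeister3 (project \<kappa> D) (project \<kappa>' E)"
    proof cases
      case 1
      show ?thesis
        by (rule reidemeister3I[OF ne tr'' triD' triE' order])
          (simp_all only: ovD ovE, use 1 adm in blast)
    next
      case 2
      show ?thesis
        by (rule reidemeister3I[OF ne tr'' triD' triE' order])
          (simp_all only: ovD ovE, use 2 P_def Q_def in blast)
    next
      case 3
      show ?thesis
        by (rule reidemeister3I[OF ne(1)[symmetric] ne(3) ne(2) _
              triangle_swap12[OF triD'] triangle_swap12[OF triE']])
          (simp_all only: ovD ovE tr'' perm asym, use 3 in blast)
    next
      case 4
      show ?thesis
        by (rule reidemeister3I[OF ne(2)[symmetric] ne(3)[symmetric] ne(1) _
              triangle_swap12[OF triangle_swap23[OF triD']]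
              triangle_swap12[OF triangle_swap23[OF triE']]])
          (simp_all only: ovD ovE tr'' perm asym, use 4 in blast)
    qed
  qed simp
qed

section \<open>Projection and planar isotopy\<close>

context
  fixes f :: "real \<Rightarrow> real"
  assumes f: "circle_reparam f"
begin

lemma circle_reparam_deriv: "(f has_real_derivative vector_derivative f (at s)) (at s)"
  using f unfolding circle_reparam_def C1_differentiable_on_eq
  by (simp add: has_real_derivative_iff_has_vector_derivative vector_derivative_works)

lemma circle_reparam_strict_mono: "strict_mono f"
proof (rule strict_monoI)
  fix s t :: real assume "s < t"
  then show "f s < f t"
    by (rule DERIV_pos_imp_increasing)
      (use circle_reparam_deriv f in \<open>auto simp: circle_reparam_def\<close>)
qed

lemma circle_reparam_period_nat: "f (s + 2 * pi * real k) = f s + 2 * pi * real k"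
proof (induction k)
  case (Suc k)
  have "f (s + 2 * pi * real (Suc k)) = f ((s + 2 * pi * real k) + 2 * pi)"
    by (simp add: algebra_simps)
  also have "\<dots> = f (s + 2 * pi * real k) + 2 * pi"
    using f unfolding circle_reparam_def by blast
  finally show ?case using Suc by (simp add: algebra_simps)
qed simp

lemma circle_reparam_period: "f (s + 2 * pi * real_of_int n) = f s + 2 * pi * real_of_int n"
proof (cases "0 \<le> n")
  case True
  then show ?thesis using circle_reparam_period_nat[of s "nat n"] by simp
next
  case False
  then show ?thesis
    using circle_reparam_period_nat[of "s + 2 * pi * real_of_int n" "nat (- n)"] by simp
qed

text \<open>Commuting with whole turns makes \<open>f\<close> unbounded in both directions; the
  intermediate value theorem fills the gaps.\<close>

lemma circle_reparam_surj: "surj f"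
  unfolding surj_def
proof
  fix y
  obtain k :: nat where k: "\<bar>y - f 0\<bar> / (2 * pi) \<le> real k" using real_arch_simple by blast
  then have "\<bar>y - f 0\<bar> \<le> 2 * pi * real k" by (simp add: field_simps)
  moreover have "f (2 * pi * real k) = f 0 + 2 * pi * real k"
    using circle_reparam_period[of 0 "int k"] by simp
  moreover have "f (- (2 * pi * real k)) = f 0 - 2 * pi * real k"
    using circle_reparam_period[of 0 "- int k"] by simp
  ultimately have "f (- (2 * pi * real k)) \<le> y" "y \<le> f (2 * pi * real k)" by linarith+
  moreover have "continuous_on {- (2 * pi * real k)..2 * pi * real k} f"
    using circle_reparam_deriv DERIV_isCont by (blast intro: continuous_at_imp_continuous_on)
  ultimately show "\<exists>x. y = f x"
    using IVT'[of f "- (2 * pi * real k)" y "2 * pi * real k"] by auto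
qed

text \<open>Commuting with whole turns makes \<open>f\<close> well defined on the circle, and strict
  monotonicity makes it injective there.\<close>

lemma circle_reparam_cis_iff: "cis (f s) = cis (f t) \<longleftrightarrow> cis s = cis t"
proof
  assume "cis s = cis t"
  then obtain n :: int where "s = t + 2 * pi * n" using cis_eq_cis_iff by blast
  then show "cis (f s) = cis (f t)"
    using circle_reparam_period cis_eq_cis_iff by metis
next
  assume "cis (f s) = cis (f t)"
  then obtain n :: int where "f s = f t + 2 * pi * n" using cis_eq_cis_iff by blast
  then have "f s = f (t + 2 * pi * n)" using circle_reparam_period by simp
  then have "s = t + 2 * pi * n" using strict_mono_eq[OF circle_reparam_strict_mono] by simp
  then show "cis s = cis t" using cis_eq_cis_iff by blast
qed

end

text \<open>The counts of crossings between corresponding parameters agree. An equivalence is stated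
  because \<open>transports\<close> has to carry labels in both directions.\<close>

lemma labelling_reparam:
  assumes \<pi>: "bij_betw \<pi> {..<n} {..<n}" and f: "\<And>i. i < n \<Longrightarrow> circle_reparam (f i)"
    and C: "\<And>i s. i < n \<Longrightarrow> (i, cis s) \<in> C' \<longleftrightarrow> (\<pi> i, cis (f i s)) \<in> C"
    and \<kappa>: "\<And>i s. i < n \<Longrightarrow> \<kappa>' (i, cis s) = \<kappa> (\<pi> i, cis (f i s))"
  shows "alternating n C' \<kappa>' \<longleftrightarrow> alternating n C \<kappa>"
proof -
  have ob: "odd_between C' i s s' \<longleftrightarrow> odd_between C (\<pi> i) (f i s) (f i s')" if "i < n" for i s s'
    by (rule odd_between_reparam[OF circle_reparam_strict_mono circle_reparam_surj])
      (use f that C in auto)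
  show ?thesis
  proof
    assume alt: "alternating n C \<kappa>"
    show "alternating n C' \<kappa>'"
      unfolding alternating_def
    proof (intro allI impI)
      fix i and s s' :: real assume i: "i < n" and "s \<le> s'"
      then have "f i s \<le> f i s'" "\<pi> i < n"
        using strict_mono_less_eq[OF circle_reparam_strict_mono[OF f[OF i]]] \<pi>
        by (auto dest: bij_betwE)
      then show "\<kappa>' (i, cis s') = (\<kappa>' (i, cis s) \<noteq> odd_between C' i s s')"
        using alternatingD[OF alt] \<kappa>[OF i] ob[OF i] by simp
    qed
  next
    assume alt: "alternating n C' \<kappa>'"
    show "alternating n C \<kappa>"
      unfolding alternating_def
    proof (intro allI impI)
      fix j and u u' :: real assume j: "j < n" and "u \<le> u'"
      obtain i where i: "i < n" "j = \<pi> i" using j \<pi> unfolding bij_betw_def by auto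
      obtain s s' where s: "u = f i s" "u' = f i s'"
        using circle_reparam_surj[OF f[OF i(1)]] by (metis surjD)
      then have "s \<le> s'"
        using strict_mono_less_eq[OF circle_reparam_strict_mono[OF f[OF i(1)]]] \<open>u \<le> u'\<close> by simp
      then show "\<kappa> (j, cis u') = (\<kappa> (j, cis u) \<noteq> odd_between C j u u')"
        using alternatingD[OF alt i(1)] \<kappa>[OF i(1)] ob[OF i(1)] s i(2) by simp
    qed
  qed
qed

lemma circles_cis: "x \<in> circles D \<longleftrightarrow> (\<exists>i s. i < ncomp D \<and> x = (i, cis s))"
proof
  assume "x \<in> circles D"
  then have "fst x < ncomp D" "snd x \<in> sphere 0 1" by (auto simp: circles_def)
  moreover from this(2) obtain s where "snd x = cis s" by (rule sphere_cis_from[of _ 0])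
  ultimately show "\<exists>i s. i < ncomp D \<and> x = (i, cis s)" by (metis prod.collapse)
qed (auto simp: circles_def)

lemma classical_points_iff:
  "x \<in> classical_points D \<longleftrightarrow> (\<exists>y. y \<in> circles D \<and> classical_pair D x y)"
  unfolding classical_points_def classical_pair_def double_pair_def by blast

lemma even_at_circles:
  "even_at D \<kappa> x \<longleftrightarrow> (\<exists>y. y \<in> circles D \<and> double_pair D x y \<and> \<kappa> x \<noteq> \<kappa> y)"
  unfolding even_at_def double_pair_def by blast

text \<open>Double points correspond because the final map of the isotopy is injective. So labels
  and parities travel along the renumbering and reparametrisation of the circles, and the same data
  relate the projections.\<close>

lemma isotopic_transports:
  assumes "isotopic D E"
  shows "transports isotopic D E"
proof -
  define n where "n = ncomp D"
  obtain H \<pi> f where D: "virtual_link_diagram D" and E: "virtual_link_diagram E"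
    and n': "ncomp E = n" and H: "ambient_isotopy H" and \<pi>: "bij_betw \<pi> {..<n} {..<n}"
    and f: "\<And>i. i < n \<Longrightarrow> circle_reparam (f i)"
    and p: "\<And>i s. i < n \<Longrightarrow> pos E (i, cis s) = H 1 (pos D (\<pi> i, cis (f i s)))"
    and o: "\<And>i s. i < n \<Longrightarrow> (i, cis s) \<in> over E \<longleftrightarrow> (\<pi> i, cis (f i s)) \<in> over D"
    using assms unfolding isotopic_def n_def by metis
  have injH: "inj (H 1)" using H unfolding ambient_isotopy_def by (simp add: bij_is_inj)
  have \<pi>_lt: "\<pi> i < n" if "i < n" for i using \<pi> that by (auto dest: bij_betwE)
  have \<pi>_eq: "\<pi> i = \<pi> j \<longleftrightarrow> i = j" if "i < n" "j < n" for i j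
    using \<pi> that unfolding bij_betw_def by (auto dest: inj_onD)
  have circE: "x \<in> circles E \<longleftrightarrow> (\<exists>i s. i < n \<and> x = (i, cis s))" for x
    using circles_cis n' by simp
  have circD: "x \<in> circles D \<longleftrightarrow> (\<exists>i s. i < n \<and> x = (\<pi> i, cis (f i s)))" for x
  proof
    assume "x \<in> circles D"
    then obtain j u where j: "j < n" "x = (j, cis u)" using circles_cis n_def by blast
    obtain i where i: "i < n" "j = \<pi> i" using j \<pi> unfolding bij_betw_def by auto
    obtain s where "u = f i s" using circle_reparam_surj[OF f[OF i(1)]] by (metis surjD)
    with i j show "\<exists>i s. i < n \<and> x = (\<pi> i, cis (f i s))" by blast
  qed (use \<pi>_lt circles_cis n_def in blast)
  \<comment> \<open>Points of both diagrams are addressed by the parameters of \<open>E\<close>, so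
    that quantifiers over partners match on the two sides.\<close>
  have exE: "(\<exists>y. y \<in> circles E \<and> Q y) \<longleftrightarrow> (\<exists>j t. j < n \<and> Q (j, cis t))" for Q
    unfolding circE by blast
  have exD: "(\<exists>y. y \<in> circles D \<and> Q y) \<longleftrightarrow> (\<exists>j t. j < n \<and> Q (\<pi> j, cis (f j t)))" for Q
    unfolding circD by blast
  have dp: "double_pair E (i, cis s) (j, cis t) \<longleftrightarrow>
      double_pair D (\<pi> i, cis (f i s)) (\<pi> j, cis (f j t))" if ij: "i < n" "j < n" for i j s t
  proof -
    have "(i, cis s) \<in> circles E" "(j, cis t) \<in> circles E"
      "(\<pi> i, cis (f i s)) \<in> circles D" "(\<pi> j, cis (f j t)) \<in> circles D"
      using circE circD ij by blast+
    moreover have "pos E (i, cis s) = pos E (j, cis t) \<longleftrightarrow>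
        pos D (\<pi> i, cis (f i s)) = pos D (\<pi> j, cis (f j t))"
      using p ij inj_eq[OF injH] by simp
    moreover have "(i, cis s) = (j, cis t) \<longleftrightarrow> (\<pi> i, cis (f i s)) = (\<pi> j, cis (f j t))"
      using \<pi>_eq[OF ij] circle_reparam_cis_iff[OF f[OF ij(1)]] by auto
    ultimately show ?thesis unfolding double_pair_def by blast
  qed
  have cp: "(i, cis s) \<in> classical_points E \<longleftrightarrow> (\<pi> i, cis (f i s)) \<in> classical_points D"
    if i: "i < n" for i s
  proof -
    have "(i, cis s) \<in> classical_points E \<longleftrightarrow>
        (\<exists>j t. j < n \<and> classical_pair E (i, cis s) (j, cis t))"
      unfolding classical_points_iff exE ..
    also have "\<dots> \<longleftrightarrow> (\<exists>j t. j < n \<and> classical_pair D (\<pi> i, cis (f i s)) (\<pi> j, cis (f j t)))"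
      unfolding classical_pair_def using dp o i by (simp cong: conj_cong)
    also have "\<dots> \<longleftrightarrow> (\<pi> i, cis (f i s)) \<in> classical_points D"
      unfolding classical_points_iff exD ..
    finally show ?thesis .
  qed
  have main: "(labelling E \<kappa>' \<longleftrightarrow> labelling D \<kappa>) \<and> isotopic (project \<kappa> D) (project \<kappa>' E)"
    if \<kappa>: "\<And>i s. i < n \<Longrightarrow> \<kappa>' (i, cis s) = \<kappa> (\<pi> i, cis (f i s))" for \<kappa> \<kappa>'
  proof
    show "labelling E \<kappa>' \<longleftrightarrow> labelling D \<kappa>"
      unfolding n' n_def[symmetric] by (rule labelling_reparam[OF \<pi>, of f]) (use f cp \<kappa> in auto)
    have "even_at E \<kappa>' (i, cis s) \<longleftrightarrow> even_at D \<kappa> (\<pi> i, cis (f i s))" if i: "i < n" for i s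
    proof -
      have "even_at E \<kappa>' (i, cis s) \<longleftrightarrow>
          (\<exists>j t. j < n \<and> double_pair E (i, cis s) (j, cis t) \<and> \<kappa>' (i, cis s) \<noteq> \<kappa>' (j, cis t))"
        unfolding even_at_circles exE ..
      also have "\<dots> \<longleftrightarrow> (\<exists>j t. j < n \<and> double_pair D (\<pi> i, cis (f i s)) (\<pi> j, cis (f j t)) \<and>
          \<kappa> (\<pi> i, cis (f i s)) \<noteq> \<kappa> (\<pi> j, cis (f j t)))"
        using dp[OF i] \<kappa> i by (simp cong: conj_cong)
      also have "\<dots> \<longleftrightarrow> even_at D \<kappa> (\<pi> i, cis (f i s))"
        unfolding even_at_circles exD ..
      finally show ?thesis .
    qed
    then show "isotopic (project \<kappa> D) (project \<kappa>' E)"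
      unfolding isotopic_def
      using virtual_link_diagram_project D E n' n_def H \<pi> f p o
      by (intro conjI exI[of _ H] exI[of _ \<pi>] exI[of _ f]) auto
  qed
  show ?thesis
    unfolding transports_def
  proof (intro conjI allI impI)
    fix \<kappa> assume lab: "labelling D \<kappa>"
    \<comment> \<open>\<open>Arg\<close> merely selects a lift; by
      \<open>circle_reparam_cis_iff\<close>, every other lift leads to the same point.\<close>
    define \<kappa>' where "\<kappa>' = (\<lambda>(i, w). \<kappa> (\<pi> i, cis (f i (Arg w))))"
    have "cis (f i (Arg (cis s))) = cis (f i s)" if "i < n" for i s
      using circle_reparam_cis_iff[OF f[OF that]] cis_Arg[of "cis s"] by (simp add: sgn_div_norm)
    then have "\<kappa>' (i, cis s) = \<kappa> (\<pi> i, cis (f i s))" if "i < n" for i s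
      using that by (simp add: \<kappa>'_def)
    then show "\<exists>\<kappa>'. labelling E \<kappa>' \<and> isotopic (project \<kappa> D) (project \<kappa>' E)"
      using main[of \<kappa>' \<kappa>] lab by blast
  next
    fix \<kappa>' assume lab: "labelling E \<kappa>'"
    define g where "g j = inv_into {..<n} \<pi> j" for j
    define \<kappa> where "\<kappa> = (\<lambda>(j, w). \<kappa>' (g j, cis (inv (f (g j)) (Arg w))))"
    have "\<kappa>' (i, cis s) = \<kappa> (\<pi> i, cis (f i s))" if i: "i < n" for i s
    proof -
      have g: "g (\<pi> i) = i" using \<pi> i unfolding g_def bij_betw_def by (simp add: inv_into_f_f)
      have "cis (f i (inv (f i) (Arg (cis (f i s))))) = cis (f i s)"
        using surj_f_inv_f[OF circle_reparam_surj[OF f[OF i]]] cis_Arg[of "cis (f i s)"]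
        by (simp add: sgn_div_norm)
      then have "cis (inv (f i) (Arg (cis (f i s)))) = cis s"
        using circle_reparam_cis_iff[OF f[OF i]] by blast
      then show ?thesis using g by (simp add: \<kappa>_def)
    qed
    then show "\<exists>\<kappa>. labelling D \<kappa> \<and> isotopic (project \<kappa> D) (project \<kappa>' E)"
      using main[of \<kappa>' \<kappa>] lab by blast
  qed
qed

section \<open>Projections of equivalent diagrams\<close>

lemma transports_mono:
  assumes "transports M D E" "\<And>A B. M A B \<Longrightarrow> M' A B"
  shows "transports M' D E"
  using assms unfolding transports_def by blast

lemma virtual_move_transports:
  assumes "virtual_move D E"
  shows "transports virtual_move D E"
proof -
  consider "isotopic D E" | "reidemeister1 D E" | "reidemeister2 D E" | "reidemeister3 D E"
    using assms unfolding virtual_move_def by blast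
  then show ?thesis
  proof cases
    case 1
    show ?thesis
      by (rule transports_mono[OF isotopic_transports[OF 1]]) (simp add: virtual_move_def)
  next
    case 2
    show ?thesis
      by (rule transports_mono[OF reidemeister1_transports[OF 2]]) (simp add: virtual_move_def)
  next
    case 3
    show ?thesis
      by (rule transports_mono[OF reidemeister2_transports[OF 3]]) (simp add: virtual_move_def)
  next
    case 4
    show ?thesis
      by (rule transports_mono[OF reidemeister3_transports[OF 4]]) (simp add: virtual_move_def)
  qed
qed

lemma virtual_move_diagrams:
  "virtual_move D E \<Longrightarrow> virtual_link_diagram D \<and> virtual_link_diagram E"
  unfolding virtual_move_def isotopic_def reidemeister1_def reidemeister2_def reidemeister3_def
    tangle_replacement_def
  by blast

lemma virtually_equivalent_diagram:
  assumes "virtually_equivalent D E" "virtual_link_diagram D"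
  shows "virtual_link_diagram E"
  using assms unfolding virtually_equivalent_def
  by (induction rule: rtranclp_induct) (auto simp: symclp_def dest: virtual_move_diagrams)

lemma virtually_equivalent_sym: "virtually_equivalent D E \<Longrightarrow> virtually_equivalent E D"
  unfolding virtually_equivalent_def
  using symp_rtranclp_symclp[of virtual_move] by (rule sympD)

lemma virtually_equivalent_trans:
  "virtually_equivalent D E \<Longrightarrow> virtually_equivalent E F \<Longrightarrow> virtually_equivalent D F"
  unfolding virtually_equivalent_def by (rule rtranclp_trans)

lemma virtually_equivalent_project:
  assumes "virtually_equivalent D E" "labelling D \<kappa>"
  shows "\<exists>\<kappa>'. labelling E \<kappa>' \<and> virtually_equivalent (project \<kappa> D) (project \<kappa>' E)"
  using assms unfolding virtually_equivalent_def
proof (induction rule: rtranclp_induct)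
  case base
  then show ?case by blast
next
  case (step E F)
  then obtain \<kappa>' where \<kappa>': "labelling E \<kappa>'"
    "(symclp virtual_move)\<^sup>*\<^sup>* (project \<kappa> D) (project \<kappa>' E)" by blast
  \<comment> \<open>A step may be a move in either direction; each half of \<open>transports\<close>
    serves one of them.\<close>
  have "\<exists>\<kappa>''. labelling F \<kappa>'' \<and> symclp virtual_move (project \<kappa>' E) (project \<kappa>'' F)"
    using step.hyps(2) virtual_move_transports \<kappa>'(1) unfolding symclp_def transports_def by blast
  then show ?case using \<kappa>'(2) rtranclp.rtrancl_into_rtrancl by metis
qed

section \<open>Minimal diagrams\<close>

lemma classical_crossings_project:
  "virtual_link_diagram D \<Longrightarrow> classical_crossings (project \<kappa> D) \<subseteq> classical_crossings D"
  unfolding classical_crossings_def by (auto simp: classical_pair_project)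

lemma finite_classical_crossings:
  assumes "virtual_link_diagram D"
  shows "finite (classical_crossings D)"
proof -
  have "classical_crossings D \<subseteq> pos D ` classical_points D"
    unfolding classical_crossings_def classical_points_def by blast
  then show ?thesis using finite_classical_points[OF assms] finite_subset by blast
qed

text \<open>Projection can only remove crossings, so the bound says that it removes none. A
  classical crossing of the projection at the same place has the same two preimages, possibly
  exchanged.\<close>

lemma all_crossings_even:
  assumes D: "virtual_link_diagram D" and le: "crossing_number D \<le> crossing_number (project \<kappa> D)"
    and xy: "classical_pair D x y"
  shows "\<kappa> x \<noteq> \<kappa> y"
proof -
  have "classical_crossings (project \<kappa> D) = classical_crossings D"
    by (rule card_seteq[OF finite_classical_crossings[OF D] classical_crossings_project[OF D]])
      (use le in \<open>simp add: crossing_number_def\<close>)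
  then have "pos D x \<in> classical_crossings (project \<kappa> D)"
    using xy unfolding classical_crossings_def by blast
  then obtain x' y' where x': "classical_pair D x' y'" "\<kappa> x' \<noteq> \<kappa> y'" "pos D x' = pos D x"
    unfolding classical_crossings_def project_geometry classical_pair_project[OF D] by force
  have dp: "double_pair D x y" "double_pair D x' y'" using xy x' unfolding classical_pair_def by auto
  show ?thesis
  proof (cases "x' = x")
    case True
    then have "y' = y" using dp double_pair_unique[OF D] by blast
    then show ?thesis using x' True by simp
  next
    case False
    then have "double_pair D x x'" "double_pair D x' x"
      using dp x'(3) unfolding double_pair_def by auto
    then have "x' = y" "y' = x" using dp double_pair_unique[OF D] by blast+
    then show ?thesis using x'(2) by auto
  qed
qed

lemma project_all_even:
  assumes "virtual_link_diagram D" "\<And>x y. classical_pair D x y \<Longrightarrow> \<kappa> x \<noteq> \<kappa> y"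
  shows "project \<kappa> D = D"
proof -
  have "even_at D \<kappa> x" if x: "x \<in> over D" for x
  proof -
    obtain y where y: "double_pair D x y"
      using assms(1) x unfolding virtual_link_diagram_def by blast
    then have "classical_pair D x y" using x unfolding classical_pair_def by blast
    then show ?thesis using y assms(2) unfolding even_at_def by blast
  qed
  then have "{x \<in> over D. even_at D \<kappa> x} = over D" by blast
  then show ?thesis unfolding project_def by simp
qed

section \<open>Shadings of the surface\<close>

lemma rotate_in_circles: "(i, z) \<in> circles D \<Longrightarrow> (i, z * cis t) \<in> circles D"
  by (simp add: circles_def norm_mult)

section \<open>Points of the surface as classes of the plumbing\<close>

context
  fixes D :: vdiagram and e :: real
  assumes D: "virtual_link_diagram D" and e: "disc_width D e"
begin

text \<open>The discs are embedded and disjoint, so a point of a disc determines its centre and its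
  coordinate along the strand, normalised to the range from -1 to 1.\<close>

lemma disc_eq:
  assumes "(i, z) \<in> classical_points D" "(i, w) \<in> classical_points D"
    and "a \<in> {-1..1}" "b \<in> {-1..1}" "z * cis (e * a) = w * cis (e * b)"
  shows "z = w \<and> a = b"
proof -
  have e0: "0 < e" and inj: "inj_on (\<lambda>((i, z), s). (i, z * cis s)) (classical_points D \<times> {-e..e})"
    using e unfolding disc_width_def by auto
  have range: "e * a \<in> {-e..e}" if "a \<in> {-1..1}" for a
    using that e0 mult_left_mono[of a 1 e] mult_left_mono[of "-1" a e] by auto
  have "((i, z), e * a) = ((i, w), e * b)"
    by (rule inj_onD[OF inj]) (use assms range in auto)
  then show ?thesis using e0 by simp
qed

lemma disc_classical_iff:
  assumes "(i, z) \<in> classical_points D" "a \<in> {-1..1}"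
  shows "(i, z * cis (e * a)) \<in> classical_points D \<longleftrightarrow> a = 0"
proof
  assume "(i, z * cis (e * a)) \<in> classical_points D"
  then show "a = 0" using disc_eq[of i z "z * cis (e * a)" a 0] assms by simp
qed (use assms in simp)

lemma classical_pair_sign:
  assumes "classical_pair D x y"
  shows "sgn (cdet (velocity D x) (velocity D y)) \<in> {-1, 1}"
    "sgn (cdet (velocity D y) (velocity D x)) = - sgn (cdet (velocity D x) (velocity D y))"
proof -
  have "cdet (velocity D x) (velocity D y) \<noteq> 0"
    using assms D unfolding classical_pair_def virtual_link_diagram_def generic_immersion_def by blast
  then show "sgn (cdet (velocity D x) (velocity D y)) \<in> {-1, 1}" by (auto simp: sgn_if)
  have "cdet (velocity D y) (velocity D x) = - cdet (velocity D x) (velocity D y)"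
    by (simp add: cdet_def algebra_simps)
  then show "sgn (cdet (velocity D y) (velocity D x)) = - sgn (cdet (velocity D x) (velocity D y))"
    by (simp add: sgn_minus)
qed

lemma plumbing_sym:
  assumes "(p, q) \<in> plumbing D e"
  shows "(q, p) \<in> plumbing D e"
proof -
  obtain i z j w \<sigma> a b where cl: "classical_pair D (i, z) (j, w)"
    and \<sigma>: "\<sigma> = sgn (cdet (velocity D (i, z)) (velocity D (j, w)))"
    and ab: "a \<in> {-1..1}" "b \<in> {-1..1}"
    and p: "p = (i, z * cis (e * a), b)" and q: "q = (j, w * cis (e * \<sigma> * b), - \<sigma> * a)"
    using assms unfolding plumbing_def by blast
  have s: "\<sigma> \<in> {-1, 1}" "- \<sigma> = sgn (cdet (velocity D (j, w)) (velocity D (i, z)))"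
    using classical_pair_sign[OF cl] \<sigma> by auto
  \<comment> \<open>These are the coordinates in the square of the other strand. The opposite
    quarter turn, which belongs to \<open>- \<sigma>\<close>, takes them back.\<close>
  define a' b' where "a' = \<sigma> * b" and "b' = - \<sigma> * a"
  have "a' \<in> {-1..1}" "b' \<in> {-1..1}" using s(1) ab unfolding a'_def b'_def by auto
  moreover have "q = (j, w * cis (e * a'), b')" "p = (i, z * cis (e * (- \<sigma>) * b'), - (- \<sigma>) * a')"
    using s(1) p q unfolding a'_def b'_def by auto
  ultimately show ?thesis
    unfolding plumbing_def using classical_pair_sym[OF cl] s(2) by blast
qed

text \<open>By \<open>disc_eq\<close> a point determines its crossing and its coordinates, and the
  crossing determines the other strand.\<close>

lemma plumbing_unique:
  assumes "(p, q) \<in> plumbing D e" "(p, q') \<in> plumbing D e"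
  shows "q = q'"
proof -
  obtain i z j w \<sigma> a b where 1: "classical_pair D (i, z) (j, w)"
    "\<sigma> = sgn (cdet (velocity D (i, z)) (velocity D (j, w)))"
    "a \<in> {-1..1}" "b \<in> {-1..1}"
    "p = (i, z * cis (e * a), b)" "q = (j, w * cis (e * \<sigma> * b), - \<sigma> * a)"
    using assms(1) unfolding plumbing_def by blast
  obtain i' z' j' w' \<sigma>' a' b' where 2: "classical_pair D (i', z') (j', w')"
    "\<sigma>' = sgn (cdet (velocity D (i', z')) (velocity D (j', w')))"
    "a' \<in> {-1..1}" "b' \<in> {-1..1}"
    "p = (i', z' * cis (e * a'), b')" "q' = (j', w' * cis (e * \<sigma>' * b'), - \<sigma>' * a')"
    using assms(2) unfolding plumbing_def by blast
  have "(i, z) \<in> classical_points D" "(i, z') \<in> classical_points D"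
    using 1 2 unfolding classical_points_def by auto
  then have "z = z' \<and> a = a'" using disc_eq[of i z z' a a'] 1 2 by auto
  moreover have "(j, w) = (j', w')"
    using 1 2 \<open>z = z' \<and> a = a'\<close> double_pair_unique[OF D] unfolding classical_pair_def by blast
  ultimately show ?thesis using 1 2 by auto
qed

text \<open>A symmetric partial function is an involution on its domain, so a second step of the
  plumbing leads back and classes have at most two points.\<close>

lemma surface_point_eq: "surface_point D e p = {p} \<union> plumbing D e `` {p}"
proof -
  have "q = p \<or> (p, q) \<in> plumbing D e" if "(p, q) \<in> (plumbing D e)\<^sup>*" for q
    using that
  proof (induction rule: rtrancl_induct)
    case (step q r)
    then show ?case using plumbing_sym plumbing_unique by blast
  qed simp
  then show ?thesis unfolding surface_point_def by auto
qed

lemma surface_point_eq_iff: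
  "surface_point D e p = surface_point D e q \<longleftrightarrow> p = q \<or> (p, q) \<in> plumbing D e"
proof
  assume "surface_point D e p = surface_point D e q"
  then have "q \<in> surface_point D e p" unfolding surface_point_eq by blast
  then show "p = q \<or> (p, q) \<in> plumbing D e" unfolding surface_point_eq by blast
next
  assume "p = q \<or> (p, q) \<in> plumbing D e"
  then show "surface_point D e p = surface_point D e q"
    using plumbing_sym plumbing_unique unfolding surface_point_eq by blast
qed

text \<open>Within a disc, the core of one annulus is glued to the segment over the crossing in the
  other. So the whole segment over a classical point lies on the curve.\<close>

lemma surface_point_on_curve_iff:
  assumes "(i, z) \<in> circles D"
  shows "surface_point D e (i, z, b) \<in> underlying_curve D e \<longleftrightarrow>
    b = 0 \<or> (i, z) \<in> classical_points D \<and> b \<in> {-1..1}"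
proof
  assume "surface_point D e (i, z, b) \<in> underlying_curve D e"
  then obtain j w where "surface_point D e (i, z, b) = surface_point D e (j, w, 0)"
    unfolding underlying_curve_def by blast
  then consider "b = 0" | "((i, z, b), (j, w, 0)) \<in> plumbing D e"
    using surface_point_eq_iff by auto
  then show "b = 0 \<or> (i, z) \<in> classical_points D \<and> b \<in> {-1..1}"
  proof cases
    case 2
    then obtain z' w' \<sigma> a where cl: "classical_pair D (i, z') (j, w')"
      and \<sigma>: "\<sigma> = sgn (cdet (velocity D (i, z')) (velocity D (j, w')))"
      and b: "b \<in> {-1..1}" and z: "z = z' * cis (e * a)" and a: "- \<sigma> * a = 0"
      unfolding plumbing_def by auto
    have "a = 0" using a classical_pair_sign(1)[OF cl] \<sigma> by auto
    then show ?thesis using cl z b unfolding classical_points_def by auto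
  qed simp
next
  assume *: "b = 0 \<or> (i, z) \<in> classical_points D \<and> b \<in> {-1..1}"
  show "surface_point D e (i, z, b) \<in> underlying_curve D e"
  proof (cases "b = 0")
    case True
    then show ?thesis using assms unfolding underlying_curve_def by blast
  next
    case False
    then obtain j w where cl: "classical_pair D (i, z) (j, w)"
      using * unfolding classical_points_def by auto
    let ?\<sigma> = "sgn (cdet (velocity D (i, z)) (velocity D (j, w)))"
    have "((i, z * cis (e * 0), b), (j, w * cis (e * ?\<sigma> * b), - ?\<sigma> * 0)) \<in> plumbing D e"
      unfolding plumbing_def using cl * False by force
    then have "surface_point D e (i, z, b) = surface_point D e (j, w * cis (e * ?\<sigma> * b), 0)"
      using surface_point_eq_iff by simp
    moreover have "(j, w * cis (e * ?\<sigma> * b)) \<in> circles D"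
      using cl rotate_in_circles unfolding classical_pair_def double_pair_def by blast
    ultimately show ?thesis unfolding underlying_curve_def by blast
  qed
qed

text \<open>The centre is the only classical point of the disc. Half-open counting includes it in an
  interval that starts there and excludes it from one that ends there.\<close>

lemma labelling_near_crossing:
  assumes lab: "labelling D \<kappa>" and x: "(i, z) \<in> classical_points D"
    and a: "a \<in> {-1..1}"
  shows "\<kappa> (i, z * cis (e * a)) = (\<kappa> (i, z) \<noteq> (0 < a))"
proof -
  have e0: "0 < e" using e unfolding disc_width_def by blast
  have circ: "(i, z) \<in> circles D" using x classical_points_in_circles by blast
  then obtain \<theta> where \<theta>: "i < ncomp D" "z = cis \<theta>" using circles_cis by auto
  have in_disc: "(i, cis u) \<in> classical_points D \<longleftrightarrow> u = \<theta>" if "\<bar>u - \<theta>\<bar> \<le> e" for u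
  proof -
    have "(u - \<theta>) / e \<in> {-1..1}" using that e0 by (auto simp: field_simps abs_if split: if_splits)
    moreover have "z * cis (e * ((u - \<theta>) / e)) = cis u" using e0 \<theta> by (simp add: cis_mult)
    ultimately show ?thesis using disc_classical_iff[OF x, of "(u - \<theta>) / e"] e0 by simp
  qed
  have ea: "- e \<le> e * a" "e * a \<le> e" using a e0 mult_left_mono[of a 1 e] mult_left_mono[of "-1" a e] by auto
  show ?thesis
  proof (cases "0 < a")
    case True
    have "(i, cis u) \<in> classical_points D \<longleftrightarrow> u = \<theta>" if "\<theta> \<le> u" "u < \<theta> + e * a" for u
      by (rule in_disc) (use that ea in linarith)
    moreover have "\<theta> < \<theta> + e * a" using e0 True by simp
    ultimately have "{t \<in> {\<theta>..<\<theta> + e * a}. (i, cis t) \<in> classical_points D} = {\<theta>}"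
      by fastforce
    then have "odd_between (classical_points D) i \<theta> (\<theta> + e * a)" by (simp add: odd_between_def)
    then show ?thesis
      using alternatingD[OF lab \<theta>(1), of \<theta> "\<theta> + e * a"] True e0 \<theta> by (simp add: cis_mult)
  next
    case False
    then have "e * a \<le> 0" using e0 by (simp add: mult_le_0_iff)
    have "(i, cis u) \<notin> classical_points D" if "\<theta> + e * a \<le> u" "u < \<theta>" for u
      using in_disc[of u] that ea by linarith
    then have "{t \<in> {\<theta> + e * a..<\<theta>}. (i, cis t) \<in> classical_points D} = {}"
      by auto
    then have "\<not> odd_between (classical_points D) i (\<theta> + e * a) \<theta>"
      unfolding odd_between_def by (simp only: card.empty) simp
    then show ?thesis
      using alternatingD[OF lab \<theta>(1), of "\<theta> + e * a" \<theta>] False \<open>e * a \<le> 0\<close> \<theta> by (simp add: cis_mult)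
  qed
qed


text \<open>The image of a connected set in the quotient is connected, and off the curve it lies in
  a single component.\<close>

lemma same_region:
  assumes shading: "\<S> \<subseteq> regions D e" and K: "connected K" "K \<subseteq> annuli D"
    and off: "\<And>p. p \<in> K \<Longrightarrow> surface_point D e p \<notin> underlying_curve D e"
    and p: "p \<in> K" "p' \<in> K" and in_S: "surface_point D e p \<in> \<Union>\<S>"
  shows "surface_point D e p' \<in> \<Union>\<S>"
proof -
  let ?Y = "abstract_link_surface D e" and ?q = "surface_point D e"
  have "connectedin (top_of_set (annuli D)) K" using K by (simp add: connectedin_subtopology)
  moreover have "continuous_map (top_of_set (annuli D)) ?Y ?q"
    unfolding abstract_link_surface_def
    by (rule quotient_imp_continuous_map[OF quotient_map_quotient_topology])
  ultimately have "connectedin ?Y (?q ` K)" by (rule connectedin_continuous_map_image[rotated])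
  moreover from this have "?q ` K \<subseteq> topspace ?Y" by (rule connectedin_subset_topspace)
  ultimately have conn: "connectedin (subtopology ?Y (topspace ?Y - underlying_curve D e)) (?q ` K)"
    using off by (auto simp: connectedin_subtopology)
  obtain R where R: "R \<in> \<S>" "?q p \<in> R" using in_S by blast
  have "?q ` K \<subseteq> R"
    by (rule connected_components_of_maximal[OF _ conn])
      (use R p shading in \<open>auto simp: regions_def disjnt_def\<close>)
  then show ?thesis using R p by blast
qed

end

section \<open>From a shading to labels\<close>

lemma alternatingI:
  assumes C: "finite C"
    and const: "\<And>i s s'. i < n \<Longrightarrow> s \<le> s' \<Longrightarrow> (\<And>t. s \<le> t \<Longrightarrow> t < s' \<Longrightarrow> (i, cis t) \<notin> C) \<Longrightarrow>
      \<kappa> (i, cis s') = \<kappa> (i, cis s)"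
    and flip: "\<And>i s. i < n \<Longrightarrow> (i, cis s) \<in> C \<Longrightarrow> \<exists>d>0. \<kappa> (i, cis (s + d)) = (\<not> \<kappa> (i, cis s)) \<and>
      (\<forall>t. s < t \<and> t < s + d \<longrightarrow> (i, cis t) \<notin> C)"
  shows "alternating n C \<kappa>"
proof -
  have "\<kappa> (i, cis s') = (\<kappa> (i, cis s) \<noteq> odd_between C i s s')" if i: "i < n" and "s \<le> s'" for i s s'
    using that(2)
  \<comment> \<open>The first crossing after \<open>s\<close> is split off, which leaves fewer
    crossings before \<open>s'\<close>.\<close>
  proof (induction "card {t \<in> {s..<s'}. (i, cis t) \<in> C}" arbitrary: s rule: less_induct)
    case less
    let ?T = "{t \<in> {s..<s'}. (i, cis t) \<in> C}"
    have fin: "finite ?T" by (rule finite_cis_vimage[OF C])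
    show ?case
    proof (cases "?T = {}")
      case True
      then have "\<kappa> (i, cis s') = \<kappa> (i, cis s)" using const[OF i less.prems] by auto
      moreover have "\<not> odd_between C i s s'"
        unfolding odd_between_def True by simp
      ultimately show ?thesis by simp
    next
      case False
      define t where "t = Min ?T"
      have "t \<in> ?T" unfolding t_def by (rule Min_in[OF fin False])
      then have t: "s \<le> t" "t < s'" "(i, cis t) \<in> C" by auto
      have before: "(i, cis u) \<notin> C" if "s \<le> u" "u < t" for u
        using Min_le[OF fin, of u] that t unfolding t_def by auto
      obtain d where d: "d > 0" "\<kappa> (i, cis (t + d)) = (\<not> \<kappa> (i, cis t))"
        "\<And>u. t < u \<Longrightarrow> u < t + d \<Longrightarrow> (i, cis u) \<notin> C"
        using flip[OF i t(3)] by blast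
      \<comment> \<open>The flipped label is given at \<open>t + d\<close>, which may lie beyond
        \<open>s'\<close>. As no crossing lies in between, it is also the label at the nearer of the
        two.\<close>
      define m where "m = min (t + d) s'"
      have m: "t < m" "m \<le> s'" "m \<le> t + d" using d(1) t unfolding m_def by auto
      have "\<kappa> (i, cis (t + d)) = \<kappa> (i, cis m)"
      proof (rule const[OF i m(3)])
        fix u assume "m \<le> u" "u < t + d"
        then show "(i, cis u) \<notin> C" using d(3)[of u] m by auto
      qed
      then have \<kappa>m: "\<kappa> (i, cis m) = (\<not> \<kappa> (i, cis s))"
        using d(2) const[OF i t(1) before] by simp
      have "{u \<in> {s..<m}. (i, cis u) \<in> C} = {t}"
      proof -
        have "u = t" if "s \<le> u" "u < m" "(i, cis u) \<in> C" for u
          using before[of u] d(3)[of u] that m by fastforce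
        moreover have "t \<in> {u \<in> {s..<m}. (i, cis u) \<in> C}" using t m by simp
        ultimately show ?thesis unfolding atLeastLessThan_iff by blast
      qed
      then have "odd_between C i s m" by (simp add: odd_between_def)
      then have split: "odd_between C i s s' = (\<not> odd_between C i m s')"
        using odd_between_split[OF C, of s m s' i] t m by simp
      have "{u \<in> {m..<s'}. (i, cis u) \<in> C} \<subset> ?T"
      proof
        show "{u \<in> {m..<s'}. (i, cis u) \<in> C} \<subseteq> ?T" using t m by auto
        have "t \<notin> {u \<in> {m..<s'}. (i, cis u) \<in> C}" using m by simp
        then show "{u \<in> {m..<s'}. (i, cis u) \<in> C} \<noteq> ?T" using \<open>t \<in> ?T\<close> by blast
      qed
      then have "card {u \<in> {m..<s'}. (i, cis u) \<in> C} < card ?T" by (rule psubset_card_mono[OF fin])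
      from less.hyps[OF this m(2)] \<kappa>m split show ?thesis by simp
    qed
  qed
  then show ?thesis unfolding alternating_def by blast
qed

lemma colourable_imp_even_labelling:
  assumes D: "virtual_link_diagram D" and col: "chequerboard_colourable D"
  obtains \<kappa> where "labelling D \<kappa>" "\<And>x y. classical_pair D x y \<Longrightarrow> \<kappa> x \<noteq> \<kappa> y"
proof -
  obtain e \<S> where e: "disc_width D e" and sh: "chequerboard_shading D e \<S>"
    using col unfolding chequerboard_colourable_def by blast
  have e0: "0 < e" using e unfolding disc_width_def by blast
  have S: "\<S> \<subseteq> regions D e" using sh unfolding chequerboard_shading_def by blast
  let ?C = "classical_points D"
  define shaded where "shaded p \<longleftrightarrow> surface_point D e p \<in> \<Union>\<S>" for p
  have sides: "shaded (i, z, 1) \<noteq> shaded (i, z, - 1)" if "(i, z) \<in> circles D" "(i, z) \<notin> ?C" for i z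
  proof -
    have "\<forall>(i, z)\<in>circles D - ?C. \<forall>b\<in>{0<..1::real}. shaded (i, z, b) \<noteq> shaded (i, z, - b)"
      using sh unfolding chequerboard_shading_def shaded_def by blast
    then have "\<forall>b\<in>{0<..1::real}. shaded (i, z, b) \<noteq> shaded (i, z, - b)" using that by blast
    then show ?thesis by simp
  qed
  have shaded_const: "shaded (i, cis s', 1) = shaded (i, cis s, 1)"
    if i: "i < ncomp D" and s: "s \<le> s'" and free: "\<And>t. s \<le> t \<Longrightarrow> t \<le> s' \<Longrightarrow> (i, cis t) \<notin> ?C" for i s s'
  proof -
    define K where "K = (\<lambda>t. (i, cis t, 1 :: real)) ` {s..s'}"
    have "connected K"
      unfolding K_def by (intro connected_continuous_image continuous_intros) simp
    moreover have "K \<subseteq> annuli D" using i unfolding K_def annuli_def circles_def by auto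
    moreover have "surface_point D e p \<notin> underlying_curve D e" if p: "p \<in> K" for p
    proof -
      obtain t where t: "p = (i, cis t, 1)" "s \<le> t" "t \<le> s'" using p unfolding K_def by auto
      have "(i, cis t) \<in> circles D" using i by (simp add: circles_def)
      then show ?thesis
        using surface_point_on_curve_iff[OF D e, of i "cis t" 1] free t by simp
    qed
    moreover have "(i, cis s, 1) \<in> K" "(i, cis s', 1) \<in> K" using s unfolding K_def by auto
    ultimately show ?thesis using same_region[OF D e S] unfolding shaded_def by blast
  qed
  \<comment> \<open>The label is the shade of the left edge. Over a crossing the edge point lies on
    the curve and has no shade, so the label is taken at the back end of the disc, on the incoming
    arc.\<close>
  define \<kappa> where "\<kappa> x = (if x \<in> ?C then shaded (fst x, snd x * cis (- e), 1) else shaded (fst x, snd x, 1))"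
    for x
  have in_disc: "(i, z * cis (e * a)) \<in> ?C \<longleftrightarrow> a = 0" if "(i, z) \<in> ?C" "a \<in> {-1..1}" for i z a
    using disc_classical_iff[OF D e that] .
  have in_disc': "(i, cis u) \<in> ?C \<longleftrightarrow> u = t" if "(i, cis t) \<in> ?C" "\<bar>u - t\<bar> \<le> e" for i u t
    using in_disc[of i "cis t" "(u - t) / e"] that e0 by (auto simp: cis_mult field_simps abs_if split: if_splits)
  have crossing: "shaded (i, z * cis (e * a), b) = shaded (j, w * cis (e * \<sigma> * b), - \<sigma> * a)"
    if "classical_pair D (i, z) (j, w)" "\<sigma> = sgn (cdet (velocity D (i, z)) (velocity D (j, w)))"
      "a \<in> {-1..1}" "b \<in> {-1..1}" for i z j w \<sigma> a b
  proof -
    have "((i, z * cis (e * a), b), (j, w * cis (e * \<sigma> * b), - \<sigma> * a)) \<in> plumbing D e"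
      unfolding plumbing_def using that by blast
    then have "surface_point D e (i, z * cis (e * a), b) =
        surface_point D e (j, w * cis (e * \<sigma> * b), - \<sigma> * a)"
      using surface_point_eq_iff[OF D e] by blast
    then show ?thesis unfolding shaded_def by (rule arg_cong)
  qed
  \<comment> \<open>For the other strand, the two left corners of the disc are the two sides of one
    point of its arc.\<close>
  have flip: "shaded (i, z * cis e, 1) = (\<not> shaded (i, z * cis (- e), 1))" if x: "(i, z) \<in> ?C" for i z
  proof -
    obtain j w where cl: "classical_pair D (i, z) (j, w)"
      using x unfolding classical_points_def by auto
    define \<sigma> where "\<sigma> = sgn (cdet (velocity D (i, z)) (velocity D (j, w)))"
    have \<sigma>: "\<sigma> = 1 \<or> \<sigma> = - 1" using classical_pair_sign(1)[OF D e cl] unfolding \<sigma>_def by auto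
    have y: "(j, w) \<in> ?C" using classical_pair_sym[OF cl] unfolding classical_points_def by blast
    have circ: "(j, w * cis (e * \<sigma>)) \<in> circles D"
      using rotate_in_circles[OF subsetD[OF classical_points_in_circles y]] .
    have "(j, w * cis (e * \<sigma>)) \<notin> ?C" using in_disc[OF y, of \<sigma>] \<sigma> by auto
    then show ?thesis
      using sides[OF circ] crossing[OF cl \<sigma>_def, of 1 1] crossing[OF cl \<sigma>_def, of "-1" 1] \<sigma> by auto
  qed
  have lab: "labelling D \<kappa>"
  proof (rule alternatingI[OF finite_classical_points[OF D]])
    fix i and s s' :: real assume i: "i < ncomp D" and le: "s \<le> s'"
      and free: "\<And>t. s \<le> t \<Longrightarrow> t < s' \<Longrightarrow> (i, cis t) \<notin> ?C"
    show "\<kappa> (i, cis s') = \<kappa> (i, cis s)"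
    proof (cases "s = s'")
      case False
      then have s: "(i, cis s) \<notin> ?C" using free[of s] le by auto
      show ?thesis
      proof (cases "(i, cis s') \<in> ?C")
        case True
        have s'_eq: "\<kappa> (i, cis s') = shaded (i, cis (s' - e), 1)"
          using True by (simp add: \<kappa>_def cis_mult)
        \<comment> \<open>The incoming half of the disc about \<open>s'\<close> may reach back
          beyond \<open>s\<close>; it contains no other crossing either.\<close>
        have free': "(i, cis t) \<notin> ?C" if "min s (s' - e) \<le> t" "t < s'" for t
        proof (cases "s \<le> t")
          case False
          then show ?thesis using in_disc'[OF True, of t] that by auto
        qed (use free that in blast)
        have "shaded (i, cis (s' - e), 1) = shaded (i, cis s, 1)"
        proof (cases "s \<le> s' - e")
          case True
          then show ?thesis using shaded_const[OF i True] free' e0 by simp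
        next
          case False
          then show ?thesis
            using shaded_const[OF i, of "s' - e" s] free' le \<open>s \<noteq> s'\<close> by simp
        qed
        then show ?thesis using s'_eq s by (simp add: \<kappa>_def)
      next
        case False
        have "(i, cis t) \<notin> ?C" if "s \<le> t" "t \<le> s'" for t
          using free[of t] False that by (cases "t = s'") auto
        then have "shaded (i, cis s', 1) = shaded (i, cis s, 1)" using shaded_const[OF i le] by blast
        then show ?thesis using False s by (simp add: \<kappa>_def)
      qed
    qed simp
  next
    fix i s assume i: "i < ncomp D" and x: "(i, cis s) \<in> ?C"
    have "(i, cis (s + e)) \<notin> ?C" using in_disc'[OF x, of "s + e"] e0 by simp
    then have "\<kappa> (i, cis (s + e)) = (\<not> \<kappa> (i, cis s))"
      using flip[OF x] x by (simp add: \<kappa>_def cis_mult)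
    moreover have "(i, cis t) \<notin> ?C" if "s < t" "t < s + e" for t
      using in_disc'[OF x, of t] that by simp
    ultimately show "\<exists>d>0. \<kappa> (i, cis (s + d)) = (\<not> \<kappa> (i, cis s)) \<and>
        (\<forall>t. s < t \<and> t < s + d \<longrightarrow> (i, cis t) \<notin> ?C)"
      using e0 by blast
  qed
  have "\<kappa> x \<noteq> \<kappa> y" if "classical_pair D x y" for x y
  proof -
    obtain i z j w where [simp]: "x = (i, z)" "y = (j, w)" by (cases x, cases y)
    have cl: "classical_pair D (i, z) (j, w)" using that by simp
    define \<sigma> where "\<sigma> = sgn (cdet (velocity D (i, z)) (velocity D (j, w)))"
    have x: "(i, z) \<in> ?C" and y: "(j, w) \<in> ?C"
      using cl classical_pair_sym[OF cl] unfolding classical_points_def by blast+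
    have "\<kappa> x = shaded (i, z * cis (e * (-1)), 1)" "\<kappa> y = shaded (j, w * cis (- e), 1)"
      using x y by (simp_all add: \<kappa>_def)
    \<comment> \<open>The left back corner for \<open>x\<close> is, for \<open>y\<close>, the left
      front corner if \<open>\<sigma> = 1\<close> and the right back corner if
      \<open>\<sigma> = - 1\<close>. Both have the shade opposite to the left back corner for
      \<open>y\<close>.\<close>
    then have \<kappa>: "\<kappa> x = shaded (j, w * cis (e * \<sigma>), \<sigma>)" "\<kappa> y = shaded (j, w * cis (- e), 1)"
      using crossing[OF cl \<sigma>_def, of "-1" 1] by simp_all
    have "\<sigma> = 1 \<or> \<sigma> = - 1" using classical_pair_sign(1)[OF D e cl] unfolding \<sigma>_def by auto
    then show ?thesis
    proof
      assume "\<sigma> = 1"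
      then show ?thesis using \<kappa> flip[OF y] by simp
    next
      assume \<sigma>: "\<sigma> = - 1"
      have "(j, w * cis (- e)) \<in> circles D"
        using rotate_in_circles[OF subsetD[OF classical_points_in_circles y]] .
      moreover have "(j, w * cis (- e)) \<notin> ?C" using in_disc[OF y, of "-1"] by simp
      ultimately show ?thesis using \<kappa> \<sigma> sides by simp
    qed
  qed
  with lab show ?thesis by (rule that)
qed

section \<open>From labels to a shading\<close>

lemma disc_width_exists:
  assumes D: "virtual_link_diagram D"
  obtains e where "disc_width D e"
proof -
  let ?C = "classical_points D"
  have sphere: "norm (snd x) = 1" if "x \<in> ?C" for x
    using that classical_points_sphere[of D] by auto
  have dist: "norm (z * cis s - z * cis t) \<le> \<bar>s - t\<bar>" if "norm z = 1" for z s t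
  proof -
    have "z * cis s - z * cis t = z * cis t * (cis (s - t) - 1)"
      by (simp add: algebra_simps cis_mult)
    then have "norm (z * cis s - z * cis t) = norm (cis (s - t) - 1)"
      using that by (simp add: norm_mult)
    also have "\<dots> = 2 * \<bar>sin ((s - t) / 2)\<bar>"
      using dist_exp_i_1[of "s - t"] by (simp add: cis_conv_exp)
    also have "\<dots> \<le> \<bar>s - t\<bar>" using abs_sin_x_le_abs_x[of "(s - t) / 2"] by simp
    finally show ?thesis .
  qed
  \<comment> \<open>The chords between distinct positions of classical points. The element 1 keeps
    the set nonempty and bounds the width, so that no disc wraps around its circle.\<close>
  define M where "M = insert 1 ((\<lambda>(x, y). norm (snd x - snd y)) ` {(x, y) \<in> ?C \<times> ?C. snd x \<noteq> snd y})"
  have "finite {(x, y) \<in> ?C \<times> ?C. snd x \<noteq> snd y}"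
    by (rule finite_subset[of _ "?C \<times> ?C"]) (use finite_classical_points[OF D] in auto)
  then have fin: "finite M" unfolding M_def by simp
  have "1 \<in> M" unfolding M_def by simp
  have "0 < m" if "m \<in> M" for m using that unfolding M_def by auto
  then have "0 < Min M" using Min_in[OF fin] \<open>1 \<in> M\<close> by blast
  \<comment> \<open>Overlapping discs have centres at distance at most \<open>2 * e\<close>; a third
    of the minimum makes this strictly less than every chord.\<close>
  define e where "e = Min M / 3"
  have e_lt: "2 * e < m" if "m \<in> M" for m
    using Min_le[OF fin that] \<open>0 < Min M\<close> unfolding e_def by linarith
  then have e: "0 < e" "e \<le> 1"
    using \<open>0 < Min M\<close> e_lt[OF \<open>1 \<in> M\<close>] unfolding e_def by linarith+
  have "inj_on (\<lambda>((i, z), s). (i, z * cis s)) (?C \<times> {-e..e})"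
  proof (rule inj_onI, clarsimp)
    fix i z s w t
    assume z: "(i, z) \<in> ?C" and w: "(i, w) \<in> ?C" and eq: "z * cis s = w * cis t"
      and s: "- e \<le> s" "s \<le> e" "- e \<le> t" "t \<le> e"
    have zw: "z = w"
    proof (rule ccontr)
      assume "z \<noteq> w"
      then have "norm (z - w) \<in> M"
        unfolding M_def using z w by (intro insertI2 image_eqI[of _ _ "((i, z), (i, w))"]) auto
      have "norm (z - w) = norm ((z - w) * cis t)" by (simp add: norm_mult)
      also have "(z - w) * cis t = z * cis t - z * cis s" using eq by (simp add: algebra_simps)
      also have "norm \<dots> \<le> \<bar>t - s\<bar>" using dist sphere[OF z] by simp
      also have "\<dots> \<le> 2 * e" using s by simp
      finally show False using e_lt[OF \<open>norm (z - w) \<in> M\<close>] by simp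
    qed
    then have "cis s = cis t" using eq sphere[OF z] by auto
    moreover have "\<bar>s - t\<bar> < 2 * pi" using s e(2) pi_gt3 by (simp add: abs_less_iff)
    ultimately show "z = w \<and> s = t" using zw cis_eq_cis_close by blast
  qed
  with e(1) show ?thesis using that unfolding disc_width_def by blast
qed

text \<open>The classical points are finite in number, so nearby parameters avoid them, and
  continuity of \<open>Arg\<close> at 1 turns nearness to \<open>z\<close> into nearness of
  parameters. The neighbourhood is open in the plane so that it can be a factor of a product
  neighbourhood in the annuli.\<close>

lemma labelling_locally_constant:
  assumes D: "virtual_link_diagram D" and lab: "labelling D \<kappa>"
    and x: "(i, z) \<in> circles D" "(i, z) \<notin> classical_points D"
  obtains G where "open G" "z \<in> G"
    "\<And>w. w \<in> G \<Longrightarrow> w \<in> sphere 0 1 \<Longrightarrow> (i, w) \<notin> classical_points D \<and> \<kappa> (i, w) = \<kappa> (i, z)"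
proof -
  let ?C = "classical_points D"
  obtain \<theta> where i: "i < ncomp D" and z: "z = cis \<theta>" using x(1) circles_cis by auto
  define T where "T = {t \<in> {\<theta> - 1..<\<theta> + 1}. (i, cis t) \<in> ?C}"
  have "finite T" unfolding T_def by (rule finite_cis_vimage[OF finite_classical_points[OF D]])
  moreover have "\<theta> \<notin> T" using x z unfolding T_def by simp
  ultimately obtain d where d: "0 < d" "\<And>t. t \<in> T \<Longrightarrow> d \<le> dist \<theta> t"
    using finite_set_avoid[of T \<theta>] by metis
  define \<epsilon> where "\<epsilon> = min d 1"
  have \<epsilon>: "0 < \<epsilon>" "\<epsilon> \<le> 1" "\<epsilon> \<le> d" unfolding \<epsilon>_def using d(1) by auto
  have free: "(i, cis t) \<notin> ?C" if "\<bar>t - \<theta>\<bar> < \<epsilon>" for t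
  proof
    assume "(i, cis t) \<in> ?C"
    then have "t \<in> T" using that \<epsilon> unfolding T_def by (simp add: abs_less_iff)
    then show False using d(2)[of t] that \<epsilon> by (simp add: dist_real_def abs_minus_commute)
  qed
  have const: "\<kappa> (i, cis t) = \<kappa> (i, z)" if t: "\<bar>t - \<theta>\<bar> < \<epsilon>" for t
  proof -
    have none: "\<not> odd_between ?C i s s'" if "\<bar>s - \<theta>\<bar> < \<epsilon>" "\<bar>s' - \<theta>\<bar> < \<epsilon>" for s s'
    proof -
      have "{t \<in> {s..<s'}. (i, cis t) \<in> ?C} = {}" using free that by fastforce
      then show ?thesis unfolding odd_between_def by (simp only: card.empty) simp
    qed
    show ?thesis
      using alternatingD[OF lab i, of t \<theta>] alternatingD[OF lab i, of \<theta> t] none[of t \<theta>] none[of \<theta> t] t \<epsilon> z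
      by (cases "t \<le> \<theta>") auto
  qed
  have "isCont (\<lambda>w. Arg (w / z)) z"
    by (rule isCont_o2[where g = Arg])
      (use z in \<open>auto intro!: continuous_intros continuous_at_Arg simp: complex_nonpos_Reals_iff\<close>)
  then have "((\<lambda>w. Arg (w / z)) \<longlongrightarrow> Arg (z / z)) (nhds z)"
    by (simp only: isCont_def tendsto_at_iff_tendsto_nhds[of "\<lambda>w. Arg (w / z)" z])
  then have "\<forall>\<^sub>F w in nhds z. dist (Arg (w / z)) (Arg (z / z)) < \<epsilon>"
    using \<epsilon>(1) by (rule tendstoD)
  then obtain G where G: "open G" "z \<in> G" "\<And>w. w \<in> G \<Longrightarrow> \<bar>Arg (w / z)\<bar> < \<epsilon>"
    using z by (auto simp: eventually_nhds dist_real_def)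
  show ?thesis
  proof
    fix w assume w: "w \<in> G" "w \<in> sphere 0 1"
    have "cis (Arg (w / z)) = w / z"
      using w(2) z cis_Arg[of "w / z"] by (cases "w = 0") (simp_all add: sgn_div_norm norm_divide)
    then have "w = cis (\<theta> + Arg (w / z))" using z by (simp flip: cis_mult)
    then show "(i, w) \<notin> ?C \<and> \<kappa> (i, w) = \<kappa> (i, z)"
      using free[of "\<theta> + Arg (w / z)"] const[of "\<theta> + Arg (w / z)"] G(3)[OF w(1)] by simp
  qed (use G in auto)
qed

lemma even_labelling_imp_colourable:
  assumes D: "virtual_link_diagram D" and lab: "labelling D \<kappa>"
    and even: "\<And>x y. classical_pair D x y \<Longrightarrow> \<kappa> x \<noteq> \<kappa> y"
  shows "chequerboard_colourable D"
proof -
  obtain e where e: "disc_width D e" using disc_width_exists[OF D] .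
  let ?C = "classical_points D" and ?X = "top_of_set (annuli D)" and ?q = "surface_point D e"
  let ?Y = "abstract_link_surface D e" and ?curve = "underlying_curve D e"
  \<comment> \<open>The left side receives the shade \<kappa> and the right side the opposite one,
    so \<open>W True\<close> and \<open>W False\<close> are the shaded and the unshaded part of the
    annuli off the curve.\<close>
  define W where "W c = {(i, z, b :: real). (i, z) \<in> circles D - ?C \<and> b \<in> {-1..1} - {0} \<and> (\<kappa> (i, z) \<noteq> (b < 0)) = c}" for c
  have W_annuli: "W c \<subseteq> annuli D" for c unfolding W_def annuli_def by auto
  have plumb: "p' \<in> W c" if p: "p \<in> W c" and pp': "(p, p') \<in> plumbing D e" for p p' c
  proof -
    obtain i z j w \<sigma> a b where cl: "classical_pair D (i, z) (j, w)"
      and \<sigma>_def: "\<sigma> = sgn (cdet (velocity D (i, z)) (velocity D (j, w)))"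
      and a: "a \<in> {-1..1}" and b: "b \<in> {-1..1}"
      and p_eq: "p = (i, z * cis (e * a), b)" and p'_eq: "p' = (j, w * cis (e * \<sigma> * b), - \<sigma> * a)"
      using pp' unfolding plumbing_def by blast
    have x: "(i, z) \<in> ?C" and y: "(j, w) \<in> ?C"
      using cl classical_pair_sym[OF cl] unfolding classical_points_def by blast+
    have \<sigma>: "\<sigma> = 1 \<or> \<sigma> = - 1" using classical_pair_sign(1)[OF D e cl] \<sigma>_def by auto
    have "a \<noteq> 0" using p disc_classical_iff[OF D e x a] unfolding p_eq W_def by auto
    have "b \<noteq> 0" using p unfolding p_eq W_def by auto
    have \<sigma>b: "\<sigma> * b \<in> {-1..1}" and \<sigma>a: "- \<sigma> * a \<in> {-1..1}" "- \<sigma> * a \<noteq> 0"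
      using \<sigma> a b \<open>a \<noteq> 0\<close> by auto
    have circ: "(j, w * cis (e * (\<sigma> * b))) \<in> circles D"
      using rotate_in_circles[OF subsetD[OF classical_points_in_circles y]] .
    have "(j, w * cis (e * (\<sigma> * b))) \<notin> ?C"
      using disc_classical_iff[OF D e y \<sigma>b] \<sigma> \<open>b \<noteq> 0\<close> by auto
    moreover have "(\<kappa> (i, z * cis (e * a)) \<noteq> (b < 0)) = c" using p unfolding p_eq W_def by simp
    \<comment> \<open>Near a crossing, the shade is the incoming label modified by the signs of both
      coordinates. The quarter turn negates the product of the coordinates, which makes up for the
      opposite labels of the strands.\<close>
    then have "(\<kappa> (j, w * cis (e * (\<sigma> * b))) \<noteq> (- \<sigma> * a < 0)) = c"
      unfolding labelling_near_crossing[OF D e lab x a] labelling_near_crossing[OF D e lab y \<sigma>b]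
      using even[OF cl] \<sigma> \<open>a \<noteq> 0\<close> \<open>b \<noteq> 0\<close> by auto
    ultimately show ?thesis
      using circ \<sigma>a unfolding p'_eq W_def by (simp add: mult.assoc)
  qed
  have q_W: "?q p \<in> ?q ` W c \<longleftrightarrow> p \<in> W c" for p c
  proof
    assume "?q p \<in> ?q ` W c"
    then obtain p' where p': "?q p' = ?q p" "p' \<in> W c" by force
    then consider "p' = p" | "(p', p) \<in> plumbing D e" using surface_point_eq_iff[OF D e] by blast
    then show "p \<in> W c" using p'(2) plumb by cases auto
  qed blast
  have top: "topspace ?Y = ?q ` annuli D" unfolding abstract_link_surface_def by simp
  have open_W: "openin ?X (W c)" for c
  proof (subst openin_subopen, intro ballI)
    fix p assume p: "p \<in> W c"
    obtain i z b where p_eq: "p = (i, z, b)" by (cases p)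
    have x: "(i, z) \<in> circles D" "(i, z) \<notin> ?C" and b: "b \<noteq> 0" and c: "(\<kappa> (i, z) \<noteq> (b < 0)) = c"
      using p unfolding p_eq W_def by auto
    obtain G where G: "open G" "z \<in> G"
      "\<And>w. w \<in> G \<Longrightarrow> w \<in> sphere 0 1 \<Longrightarrow> (i, w) \<notin> ?C \<and> \<kappa> (i, w) = \<kappa> (i, z)"
      using labelling_locally_constant[OF D lab x] by blast
    define B where "B = (if b < 0 then {..<0} else {0::real<..})"
    have B: "open B" "b \<in> B" "\<And>b'. b' \<in> B \<Longrightarrow> b' \<noteq> 0 \<and> (b' < 0 \<longleftrightarrow> b < 0)"
      using b unfolding B_def by (auto split: if_splits)
    have "open ({i} \<times> G \<times> B)" using G(1) B(1) by (intro open_Times open_discrete)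
    then have "openin ?X (annuli D \<inter> ({i} \<times> G \<times> B))" by (rule openin_open_Int)
    moreover have "p \<in> annuli D \<inter> ({i} \<times> G \<times> B)"
      using p W_annuli G(2) B(2) unfolding p_eq by blast
    moreover have "annuli D \<inter> ({i} \<times> G \<times> B) \<subseteq> W c"
    proof
      fix p' assume p': "p' \<in> annuli D \<inter> ({i} \<times> G \<times> B)"
      then obtain w b' where p'_eq: "p' = (i, w, b')" and w: "w \<in> G" "b' \<in> B"
        and circ: "(i, w) \<in> circles D" and b': "b' \<in> {-1..1}"
        unfolding annuli_def by auto
      have "w \<in> sphere 0 1" using circ by (simp add: circles_def)
      then show "p' \<in> W c" using G(3)[OF w(1)] B(3)[OF w(2)] circ b' c unfolding p'_eq W_def by simp
    qed
    ultimately show "\<exists>T. openin ?X T \<and> p \<in> T \<and> T \<subseteq> W c" by blast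
  qed
  \<comment> \<open>\<open>W c\<close> is a union of plumbing classes, so its image is open in the
    quotient because \<open>W c\<close> itself is open.\<close>
  have open_V: "openin ?Y (?q ` W c)" for c
  proof -
    have "{p \<in> annuli D. ?q p \<in> ?q ` W c} = W c" using q_W W_annuli by blast
    then show ?thesis
      unfolding abstract_link_surface_def openin_quotient_topology
      using open_W[of c] image_mono[OF W_annuli[of c], of ?q] by simp
  qed
  have off_curve: "topspace ?Y - ?curve = ?q ` W True \<union> ?q ` W False"
  proof -
    have "?q p \<notin> ?curve \<longleftrightarrow> p \<in> W True \<union> W False" if "p \<in> annuli D" for p
      using that surface_point_on_curve_iff[OF D e] unfolding annuli_def W_def by auto
    then show ?thesis unfolding top using W_annuli by blast
  qed
  have disj: "?q ` W True \<inter> ?q ` W False = {}"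
  proof -
    have "W True \<inter> W False = {}" unfolding W_def by auto
    then show ?thesis using q_W by blast
  qed
  \<comment> \<open>The images of \<open>W True\<close> and \<open>W False\<close> are disjoint,
    open and cover all regions, so each region lies in one of them by connectedness.\<close>
  define \<S> where "\<S> = {R \<in> regions D e. R \<subseteq> ?q ` W True}"
  have in_S: "?q p \<in> \<Union>\<S> \<longleftrightarrow> p \<in> W True" for p
  proof
    show "p \<in> W True" if "?q p \<in> \<Union>\<S>" using that q_W unfolding \<S>_def by blast
    assume p: "p \<in> W True"
    let ?Z = "subtopology ?Y (topspace ?Y - ?curve)"
    have "?q p \<in> topspace ?Z" using p off_curve by auto
    then obtain R where R: "R \<in> regions D e" "?q p \<in> R"
      unfolding regions_def using Union_connected_components_of[of ?Z] by blast
    have "connectedin ?Z R"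
      using R(1) unfolding regions_def by (rule connectedin_connected_components_of)
    then have conn: "connectedin ?Y R" and sub: "R \<subseteq> ?q ` W True \<union> ?q ` W False"
      using off_curve unfolding connectedin_subtopology by auto
    have "R \<inter> ?q ` W False = {}"
    proof (rule ccontr)
      assume "R \<inter> ?q ` W False \<noteq> {}"
      then show False
        using connectedinD[OF conn open_V[of True] open_V[of False] sub] disj R(2) p by blast
    qed
    then show "?q p \<in> \<Union>\<S>" using R sub unfolding \<S>_def by blast
  qed
  have "chequerboard_shading D e \<S>"
    unfolding chequerboard_shading_def in_S
  proof (intro conjI ballI)
    show "\<S> \<subseteq> regions D e" unfolding \<S>_def by blast
    fix x assume x: "x \<in> circles D - ?C"
    obtain i z where x_eq: "x = (i, z)" by (cases x)
    have "((i, z, b) \<in> W True) \<noteq> ((i, z, - b) \<in> W True)" if "b \<in> {0<..1}" for b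
      using x that unfolding W_def x_eq by auto
    then show "case x of (i, z) \<Rightarrow> \<forall>b\<in>{0<..1}. ((i, z, b) \<in> W True) \<noteq> ((i, z, - b) \<in> W True)"
      unfolding x_eq by blast
  qed
  then show ?thesis unfolding chequerboard_colourable_def using e by blast
qed

theorem proposition3p16:
  fixes L :: "vdiagram set" and D :: vdiagram
  assumes "L \<in> oriented_virtual_links"
    and "chequerboard_colourable_link L"
    and "minimal_crossing_diagram L D"
  shows "chequerboard_colourable D"
proof -
  obtain B where B: "virtual_link_diagram B"
    and L: "\<And>E. E \<in> L \<longleftrightarrow> virtually_equivalent B E"
    using assms(1) unfolding oriented_virtual_links_def by (auto elim!: quotientE)
  have diagram: "virtual_link_diagram E" if "E \<in> L" for E
    using virtually_equivalent_diagram[OF _ B] that L by blast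
  obtain C where C: "C \<in> L" "chequerboard_colourable C"
    using assms(2) unfolding chequerboard_colourable_link_def by blast
  have D: "D \<in> L" and minimal: "\<And>E. E \<in> L \<Longrightarrow> crossing_number D \<le> crossing_number E"
    using assms(3) unfolding minimal_crossing_diagram_def by auto
  obtain \<kappa>0 where lab0: "labelling C \<kappa>0" and "\<And>x y. classical_pair C x y \<Longrightarrow> \<kappa>0 x \<noteq> \<kappa>0 y"
    using colourable_imp_even_labelling[OF diagram[OF C(1)] C(2)] by blast
  then have fixed: "project \<kappa>0 C = C" using project_all_even diagram[OF C(1)] by blast
  have "virtually_equivalent C D"
    using C(1) D L virtually_equivalent_sym virtually_equivalent_trans by blast
  then obtain \<kappa> where \<kappa>: "labelling D \<kappa>" "virtually_equivalent C (project \<kappa> D)"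
    using virtually_equivalent_project[OF _ lab0] fixed by metis
  then have "project \<kappa> D \<in> L" using C(1) L virtually_equivalent_trans by blast
  then have "\<kappa> x \<noteq> \<kappa> y" if "classical_pair D x y" for x y
    using all_crossings_even[OF diagram[OF D] minimal that] by blast
  then show ?thesis by (rule even_labelling_imp_colourable[OF diagram[OF D] \<kappa>(1)])
qed

end
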